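(* Suppose that $\mathbf{C}(\mathcal{X})$ is strongly connected and that its cyclicity $\gamma$ equals the cyclicity of $\mathcal{D}(\mathcal{X})$. Denote $u_{i,\mathcal{N}_c,j}=w_{i,\mathcal{N}_c}+v_{\mathcal{N}_c,j}$. Let $k\ge1$ be greater than or equal to $$\max\left(\max_{i,j\in N}\ \frac{u_{i,\mathcal{N}_c,j}-\alpha_{i,\mathcal{N}_c}-\beta_{\mathcal{N}_c,j}}{\lambda_*}+2(n-q)+\mathrm{Sch}(\gamma,q),\ \max_{i,j:\ \gamma_{i,j}>\varepsilon}\ \frac{u_{i,\mathcal{N}_c,j}-\gamma_{i,j}}{\lambda_*}+n-q+1\right).$$ Then for every product $\Gamma(k)=A_1\otimes\cdots\otimes A_k$ with $A_1,\dots,A_k\in\mathcal{Y}$ we have $\Gamma(k)=CS^{k\,(\mathrm{mod}\,\gamma)}R[\Gamma(k)]$.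
   Context: **Tropical algebra and digraphs.** $\mathbb{R}_{\max}=\mathbb{R}\cup\{-\infty\}$, $a\oplus b=\max(a,b)$, $a\otimes b=a+b$, $\varepsilon=-\infty$; $(A\otimes B)_{i,j}=\max_l(a_{i,l}+b_{l,j})$; matrix powers are tropical and $A^0=I$ ($0$ on the diagonal, $\varepsilon$ elsewhere). For an $n\times n$ matrix $A$, $\mathcal{D}(A)$ has nodes $1,\dots,n$ and an edge $(i,j)$ of weight $a_{i,j}$ iff $a_{i,j}\ne\varepsilon$. A walk $(i_0,\dots,i_l)$ follows edges, has length $l$ and weight the sum of its edge weights (a single node is a walk of length and weight $0$); a cycle is a walk with $i_0=i_l$, $l\ge1$; a path is a walk with no repeated node. $A$ is irreducible if $\mathcal{D}(A)$ is strongly connected. $\lambda(A)$ is the maximal mean weight (weight/length) of cycles ($\varepsilon$ if there are none). The critical digraph $\mathbf{C}(A)$ consists of all nodes and edges lying on cycles of mean weight $\lambda(A)$. The cyclicity of a strongly connected digraph is the gcd of its cycle lengths. **Standing assumptions.** $\mathcal{X}$ is a nonempty, possibly infinite, set of $n\times n$ matrices over $\mathbb{R}_{\max}$, each irreducible with finite $\lambda$; $\mathcal{Y}=\{A-\lambda(A): A\in\mathcal{X}\}$ ($\lambda(A)$ subtracted from each entry). $A^{\sup}$, $A^{\inf}$ are the entrywise supremum and infimum of the matrices in $\mathcal{Y}$; $A^{\sup}$ has all entries in $\mathbb{R}_{\max}$. All matrices of $\mathcal{X}$ and $A^{\sup}$ have the same digraph edge set, denoted $\mathcal{D}(\mathcal{X})=(N,E)$,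 and the same critical digraph, denoted $\mathbf{C}(\mathcal{X})=(\mathcal{N}_c,\mathcal{E}_c)$. For $(i,j)\in E$, $(A^{\inf})_{i,j}\neq-\infty$. For all $A\in\mathcal{Y}$: $A_{i,j}=(A^{\sup})_{i,j}=0$ for $(i,j)\in\mathcal{E}_c$, and $A_{i,j}\le0$, $(A^{\sup})_{i,j}\le 0$ for $(i,j)\notin\mathcal{E}_c$. $q=|\mathcal{N}_c|$. **CSR.** $S$ is the $n\times n$ matrix with $S_{i,j}=0$ if $(i,j)\in\mathcal{E}_c$ and $\varepsilon$ otherwise; $\gamma$ is the cyclicity of $\mathbf{C}(\mathcal{X})$; $T(S)$ is the least $T$ with $S^{l+\gamma}=S^l$ for all $l\ge T$; $t$ is any integer with $t\gamma\ge T(S)$. With $k\,(\mathrm{mod}\,\gamma)\in\{0,\dots,\gamma-1\}$, $C=\Gamma(k)\otimes S^{(t+1)\gamma-k(\mathrm{mod}\,\gamma)}$, $R=S^{(t+1)\gamma-k(\mathrm{mod}\,\gamma)}\otimes\Gamma(k)$, and $CS^{k(\mathrm{mod}\,\gamma)}R[\Gamma(k)]=C\otimes S^{k(\mathrm{mod}\,\gamma)}\otimes R$. **Weights.** $\alpha_{i,\mathcal{N}_c}$: maximal weight of a path on $\mathcal{D}(A^{\sup})$ from $i$ to a node of $\mathcal{N}_c$; $\beta_{\mathcal{N}_c,j}$: maximal weight of a path on $\mathcal{D}(A^{\sup})$ from a node of $\mathcal{N}_c$ to $j$; $w_{i,\mathcal{N}_c}$ and $v_{\mathcal{N}_c,j}$: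 the same quantities with $\mathcal{D}(A^{\inf})$ in place of $\mathcal{D}(A^{\sup})$; $\gamma_{i,j}$: maximal weight of a path on $\mathcal{D}(A^{\sup})$ from $i$ to $j$ avoiding $\mathcal{N}_c$ (for $i=j$: of a cycle through $i$ avoiding $\mathcal{N}_c$), $\varepsilon$ if none exists. $B^{\sup}$ is obtained from $A^{\sup}$ by setting to $\varepsilon$ all entries $(i,j)$ with $i\in\mathcal{N}_c$ or $j\in\mathcal{N}_c$; $\lambda_*$ is the maximum cycle mean of $B^{\sup}$ (it is $<0$). Convention: if $\lambda_*=\varepsilon$, fractions with denominator $\lambda_*$ are read as $0$ (the limit $\lambda_*\to\varepsilon$). **Schwarz's number.** $\mathrm{Wi}(n)=(n-1)^2+1$ for $n\ge1$, $\mathrm{Wi}(0)=0$; $\mathrm{Sch}(\gamma,n)=\gamma\,\mathrm{Wi}(\lfloor n/\gamma\rfloor)+n\,(\mathrm{mod}\,\gamma)$. *)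

theory Defs
  imports
    "HOL-Analysis.Finite_Cartesian_Product"
    "HOL-Library.Extended_Real"
    "Graph_Theory.Graph_Theory"
begin

section \<open>Max-plus matrices\<close>

text \<open>
  The max-plus semiring is rendered by those extended reals that differ from \<open>\<infinity>\<close>, with
  \<open>max\<close> as addition and \<open>+\<close> as multiplication; its zero is \<open>-\<infinity>\<close>. The matrices under
  consideration are explicitly required to have no entry \<open>\<infinity>\<close>.
\<close>

type_synonym 'n trop_mat = "ereal ^ 'n ^ 'n"

definition trop_mult :: "'n::finite trop_mat \<Rightarrow> 'n trop_mat \<Rightarrow> 'n trop_mat"
    (infixl "\<otimes>" 70) where
  "A \<otimes> B = (\<chi> i j. MAX l\<in>UNIV. A $ i $ l + B $ l $ j)"

definition trop_id :: "'n::finite trop_mat" where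
  "trop_id = (\<chi> i j. if i = j then 0 else -\<infinity>)"

primrec trop_pow :: "'n::finite trop_mat \<Rightarrow> nat \<Rightarrow> 'n trop_mat" where
  "trop_pow A 0 = trop_id"
| "trop_pow A (Suc l) = A \<otimes> trop_pow A l"

definition trop_prod :: "'n::finite trop_mat list \<Rightarrow> 'n trop_mat" where
  "trop_prod As = foldr (\<otimes>) As trop_id"


section \<open>Weighted digraphs, cycle means and critical digraphs\<close>

definition digraph_of :: "'n::finite trop_mat \<Rightarrow> 'n pair_pre_digraph" where
  "digraph_of A = \<lparr> pverts = UNIV, parcs = {(i, j). A $ i $ j \<noteq> -\<infinity>} \<rparr>"

text \<open>
  Walks and paths are \<^const>\<open>vwalk\<close> and \<^const>\<open>vpath\<close>, i.e. nonempty lists of nodes. A cycle is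
  any closed walk of positive length; nodes may be repeated, and loops are allowed, unlike in
  \<^const>\<open>pre_digraph.cycle\<close>.
\<close>

definition vcycle :: "'a list \<Rightarrow> 'a pair_pre_digraph \<Rightarrow> bool" where
  "vcycle p G \<longleftrightarrow> vwalk p (with_proj G) \<and> hd p = last p \<and> vwalk_length p \<ge> 1"

definition irreducible_mat :: "'n::finite trop_mat \<Rightarrow> bool" where
  "irreducible_mat A \<longleftrightarrow> strongly_connected (with_proj (digraph_of A))"

definition cyclicity :: "'a pair_pre_digraph \<Rightarrow> nat" where
  "cyclicity G = Gcd {vwalk_length p | p. vcycle p G}"

definition walk_weight :: "'n::finite trop_mat \<Rightarrow> 'n list \<Rightarrow> ereal" where
  "walk_weight A p = (\<Sum>(i, j)\<leftarrow>vwalk_arcs p. A $ i $ j)"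

definition mean_weight :: "'n::finite trop_mat \<Rightarrow> 'n list \<Rightarrow> ereal" where
  "mean_weight A p = walk_weight A p / ereal (real (vwalk_length p))"

text \<open>
  Here and below, a maximum over a possibly empty set is written as a supremum in \<^typ>\<open>ereal\<close>,
  which is \<open>-\<infinity>\<close> for the empty set.
\<close>

definition max_cycle_mean :: "'n::finite trop_mat \<Rightarrow> ereal" where
  "max_cycle_mean A = Sup {mean_weight A p | p. vcycle p (digraph_of A)}"

definition critical_cycle :: "'n::finite trop_mat \<Rightarrow> 'n list \<Rightarrow> bool" where
  "critical_cycle A p \<longleftrightarrow> vcycle p (digraph_of A) \<and> mean_weight A p = max_cycle_mean A"

definition critical_digraph :: "'n::finite trop_mat \<Rightarrow> 'n pair_pre_digraph" where
  "critical_digraph A =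
     \<lparr> pverts = (\<Union>p\<in>{p. critical_cycle A p}. set p),
       parcs = (\<Union>p\<in>{p. critical_cycle A p}. set (vwalk_arcs p)) \<rparr>"


section \<open>The set of matrices\<close>

definition normalized :: "'n::finite trop_mat \<Rightarrow> 'n trop_mat" where
  "normalized A = (\<chi> i j. A $ i $ j - max_cycle_mean A)"

definition sup_mat :: "'n::finite trop_mat set \<Rightarrow> 'n trop_mat" where
  "sup_mat Y = (\<chi> i j. SUP A\<in>Y. A $ i $ j)"

definition inf_mat :: "'n::finite trop_mat set \<Rightarrow> 'n trop_mat" where
  "inf_mat Y = (\<chi> i j. INF A\<in>Y. A $ i $ j)"

text \<open>
  In the following locale \<open>Y\<close> is the set of normalized matrices from \<open>X\<close>, \<open>D\<close> is the common
  digraph and \<open>C\<close> the common critical digraph of all matrices of \<open>X\<close> and of the supremum of \<open>Y\<close>.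
\<close>

locale common_digraphs =
  fixes X Y :: "'n::finite trop_mat set" and D C :: "'n pair_pre_digraph"
  assumes X_nonempty: "X \<noteq> {}"
    and X_entries: "A \<in> X \<Longrightarrow> A $ i $ j \<noteq> \<infinity>"
    and X_irreducible: "A \<in> X \<Longrightarrow> irreducible_mat A"
    and X_finite_mean: "A \<in> X \<Longrightarrow> \<bar>max_cycle_mean A\<bar> \<noteq> \<infinity>"
    and Y_eq: "Y = normalized ` X"
    and sup_entries: "sup_mat Y $ i $ j \<noteq> \<infinity>"
    and X_digraph: "A \<in> X \<Longrightarrow> digraph_of A = D"
    and sup_digraph: "digraph_of (sup_mat Y) = D"
    and X_critical: "A \<in> X \<Longrightarrow> critical_digraph A = C"
    and sup_critical: "critical_digraph (sup_mat Y) = C"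
    and inf_entries: "(i, j) \<in> parcs D \<Longrightarrow> inf_mat Y $ i $ j \<noteq> -\<infinity>"
    and Y_critical_zero: "A \<in> Y \<Longrightarrow> (i, j) \<in> parcs C \<Longrightarrow> A $ i $ j = 0"
    and sup_critical_zero: "(i, j) \<in> parcs C \<Longrightarrow> sup_mat Y $ i $ j = 0"
    and Y_noncritical_le: "A \<in> Y \<Longrightarrow> (i, j) \<notin> parcs C \<Longrightarrow> A $ i $ j \<le> 0"
    and sup_noncritical_le: "(i, j) \<notin> parcs C \<Longrightarrow> sup_mat Y $ i $ j \<le> 0"


section \<open>CSR products\<close>

definition support_mat :: "'n::finite pair_pre_digraph \<Rightarrow> 'n trop_mat" where
  "support_mat G = (\<chi> i j. if (i, j) \<in> parcs G then 0 else -\<infinity>)"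

definition transient :: "'n::finite trop_mat \<Rightarrow> nat \<Rightarrow> nat" where
  "transient S \<gamma> = (LEAST T. \<forall>l\<ge>T. trop_pow S (l + \<gamma>) = trop_pow S l)"

definition csr :: "'n::finite trop_mat \<Rightarrow> nat \<Rightarrow> nat \<Rightarrow> nat \<Rightarrow> 'n trop_mat \<Rightarrow> 'n trop_mat" where
  "csr S \<gamma> t k M =
     (let P = trop_pow S ((t + 1) * \<gamma> - k mod \<gamma>)
      in (M \<otimes> P) \<otimes> trop_pow S (k mod \<gamma>) \<otimes> (P \<otimes> M))"


section \<open>Optimal weights\<close>

definition max_path_to :: "'n::finite trop_mat \<Rightarrow> 'n set \<Rightarrow> 'n \<Rightarrow> ereal" where
  "max_path_to A M i =
     Sup {walk_weight A p | p. vpath p (with_proj (digraph_of A)) \<and> hd p = i \<and> last p \<in> M}"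

definition max_path_from :: "'n::finite trop_mat \<Rightarrow> 'n set \<Rightarrow> 'n \<Rightarrow> ereal" where
  "max_path_from A M j =
     Sup {walk_weight A p | p. vpath p (with_proj (digraph_of A)) \<and> hd p \<in> M \<and> last p = j}"

definition max_path_avoiding :: "'n::finite trop_mat \<Rightarrow> 'n set \<Rightarrow> 'n \<Rightarrow> 'n \<Rightarrow> ereal" where
  "max_path_avoiding A M i j =
     (if i = j
      then Sup {walk_weight A p | p. vcycle p (digraph_of A) \<and> i \<in> set p \<and> set p \<inter> M = {}}
      else Sup {walk_weight A p | p. vpath p (with_proj (digraph_of A)) \<and> hd p = i \<and> last p = j
                  \<and> set p \<inter> M = {}})"

definition remove_nodes :: "'n::finite trop_mat \<Rightarrow> 'n set \<Rightarrow> 'n trop_mat" where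
  "remove_nodes A M = (\<chi> i j. if i \<in> M \<or> j \<in> M then -\<infinity> else A $ i $ j)"


section \<open>Schwarz's number\<close>

definition Wi :: "nat \<Rightarrow> nat" where
  "Wi n = (if n = 0 then 0 else (n - 1)\<^sup>2 + 1)"

definition Sch :: "nat \<Rightarrow> nat \<Rightarrow> nat" where
  "Sch \<gamma> n = \<gamma> * Wi (n div \<gamma>) + n mod \<gamma>"


section \<open>The bound\<close>

text \<open>
  \<open>L\<close> is the maximum cycle mean outside the critical nodes, which may be \<open>-\<infinity>\<close>. In
  \<^typ>\<open>ereal\<close> one has \<open>x / -\<infinity> = 0\<close>, which is precisely the convention wanted for such fractions.
\<close>

lemma ereal_divide_MInfty: "(x::ereal) / -\<infinity> = 0"
  by (simp add: divide_ereal_def)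

definition csr_bound :: "('n::finite \<Rightarrow> 'n \<Rightarrow> ereal) \<Rightarrow> ('n \<Rightarrow> ereal) \<Rightarrow> ('n \<Rightarrow> ereal) \<Rightarrow>
    ('n \<Rightarrow> 'n \<Rightarrow> ereal) \<Rightarrow> ereal \<Rightarrow> nat \<Rightarrow> nat \<Rightarrow> nat \<Rightarrow> ereal" where
  "csr_bound u \<alpha> \<beta> g L \<gamma> n q = max
     (MAX (i, j)\<in>UNIV. (u i j - \<alpha> i - \<beta> j) / L
        + ereal (2 * (real n - real q) + real (Sch \<gamma> q)))
     (SUP (i, j)\<in>{(i, j). g i j > -\<infinity>}. (u i j - g i j) / L
        + ereal (real n - real q + 1))"

end

theory Submission
  imports Defs "HOL-Number_Theory.Cong"
begin

text \<open>
  Entries of the product are maximal weights of walks on a trellis digraph, and an entry of the CSR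
  product joins a trellis walk from \<open>i\<close> to a critical node with one from a critical node to \<open>j\<close>,
  each of length \<open>k\<close>. A walk through a critical node may be prolonged there by critical arcs of
  weight zero, which gives one inequality for such walks. Conversely, two walks of length \<open>k\<close> may be
  cut at their first, respectively last, critical node and joined inside the critical digraph, as
  soon as the remaining length is at least Schwarz's bound; equality of the two cyclicities makes
  the lengths fit modulo \<open>\<gamma>\<close>. The walks for which this fails stay long outside the critical nodes, so
  removing cycles shows that their weight is at most \<open>u i j\<close>. That value is attained, up to
  inequality, by a walk through the critical digraph, since optimal paths to and from the critical
  nodes have at most \<open>n - q\<close> arcs.

  Schwarz's bound reduces to Wielandt's bound for primitive relations, applied to the \<open>\<gamma>\<close>-step
  relation on a cyclic class that is either small and close to the start or smaller than average.
\<close>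

section \<open>Walk lengths and Schwarz's bound\<close>

text \<open>The factors are arbitrary members of \<open>Y\<close>, so there is no power of one fixed
  matrix to work with. What survives is that every critical arc has weight 0 in every factor, so a
  critical stretch may occupy any positions of the product; all other arcs are only trapped between
  \<open>inf_mat Y\<close> and \<open>sup_mat Y\<close>. Hence weights to be beaten are estimated on
  the supremum (\<open>\<alpha>\<close>, \<open>\<beta>\<close>, \<open>g\<close>), and the weight
  guaranteed in every product is measured on the infimum (\<open>u\<close>). Nonpositive entries
  make cutting off part of a walk harmless and keep \<open>\<infinity>\<close> out of the sums.

  The constants: two outer legs without cycles have at most n - q arcs each, and
  \<open>Sch \<gamma> q\<close> arcs suffice for a critical stretch of the right residue. If the
  legs are too long, together they have at least k + 1 - \<open>Sch \<gamma> q\<close> arcs, so at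
  least k + 1 - \<open>Sch \<gamma> q\<close> - 2(n - q) of them are removed in cycles of mean at
  most \<open>L\<close>. Requiring the resulting estimate to be at most \<open>u i j\<close> and
  dividing by the negative \<open>L\<close> leads to the first fraction; a walk with k arcs that
  avoids the critical nodes leads to the second.\<close>

lemma large_multiples_in_additive_set:
  fixes H :: "nat set"
  assumes zero: "0 \<in> H" and add: "\<And>x y. x \<in> H \<Longrightarrow> y \<in> H \<Longrightarrow> x + y \<in> H"
  shows "\<exists>N. \<forall>l\<ge>N. Gcd H dvd l \<longrightarrow> l \<in> H"
proof (cases "H \<subseteq> {0}")
  case True
  with zero have "H = {0}" by auto
  then show ?thesis by auto
next
  case False
  then obtain h0 where h0: "h0 \<in> H" "h0 > 0" by auto
  have mul: "c * x \<in> H" if "x \<in> H" for c x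
    by (induction c) (use zero add that in auto)
  \<comment> \<open>\<open>P d\<close> says that \<open>d\<close> is a positive difference of two
    elements of \<open>H\<close>. The least such \<open>d\<close> is the gcd: a nonzero remainder
    modulo \<open>d\<close> would be a smaller difference.\<close>
  define P where "P d \<longleftrightarrow> d > 0 \<and> (\<exists>y\<in>H. y + d \<in> H)" for d
  have "P h0" using h0 zero by (auto simp: P_def intro!: bexI[of _ 0])
  define d where "d = (LEAST d. P d)"
  have Pd: "P d" unfolding d_def by (rule LeastI[of P, OF \<open>P h0\<close>])
  have minimal: "\<not> P e" if "e < d" for e using that unfolding d_def by (rule not_less_Least)
  from Pd obtain y where d: "d > 0" and y: "y \<in> H" and x: "y + d \<in> H" by (auto simp: P_def)
  have "d dvd h" if h: "h \<in> H" for h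
  proof (rule ccontr)
    assume "\<not> d dvd h"
    then have r: "h mod d > 0" "h mod d < d" using d by (auto simp: dvd_eq_mod_eq_0)
    have "h + (h div d) * y = (h div d) * (y + d) + h mod d"
      by (simp add: algebra_simps)
    moreover have "h + (h div d) * y \<in> H" by (intro add mul h y)
    moreover have "(h div d) * (y + d) \<in> H" by (intro mul x)
    ultimately have "P (h mod d)" using r by (auto simp: P_def)
    with minimal r show False by blast
  qed
  then have "d dvd Gcd H" by (rule Gcd_greatest)
  moreover have "Gcd H dvd d"
    using Gcd_dvd[OF x] Gcd_dvd[OF y] by (simp add: dvd_add_right_iff)
  ultimately have gd: "Gcd H = d" by (simp add: dvd_antisym)
  obtain Y where Y: "y = d * Y" using Gcd_dvd[OF y] gd by auto
  \<comment> \<open>A multiple \<open>d * m\<close> uses \<open>m mod Y\<close> copies of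
    \<open>y + d\<close> and fills up with \<open>y\<close>; the threshold makes
    \<open>m div Y\<close> at least \<open>Y\<close>, so there are enough copies to
    exchange.\<close>
  have "l \<in> H" if l: "l \<ge> d * Y * Y" "d dvd l" for l
  proof (cases "Y = 0")
    case True
    with x Y have "d \<in> H" by simp
    from mul[OF this] l(2) show ?thesis by (auto simp: mult.commute)
  next
    case False
    obtain m where m: "l = d * m" using l(2) by auto
    then have "m \<ge> Y * Y" using l(1) d by (simp add: mult.assoc)
    then have "m div Y \<ge> Y" using False by (metis div_le_mono nonzero_mult_div_cancel_right)
    moreover have "m mod Y < Y" using False by simp
    ultimately have "m mod Y \<le> m div Y" by simp
    then have "(m div Y - m mod Y) * y + (m mod Y) * (y + d) = (m div Y) * y + (m mod Y) * d"
      by (simp add: algebra_simps diff_mult_distrib)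
    also have "\<dots> = d * (Y * (m div Y) + m mod Y)"
      by (simp only: Y distrib_left mult_ac)
    also have "\<dots> = l" unfolding mult_div_mod_eq m ..
    finally have "(m div Y - m mod Y) * y + (m mod Y) * (y + d) = l" .
    moreover have "(m div Y - m mod Y) * y + (m mod Y) * (y + d) \<in> H" by (intro add mul x y)
    ultimately show ?thesis by (simp only:)
  qed
  then show ?thesis using gd by auto
qed

section \<open>Relation powers, shortest walks and Wielandt's bound\<close>

lemma relpow_relpow: "(R ^^ m) ^^ n = R ^^ (m * n)" for R :: "('a \<times> 'a) set"
  by (induction n) (simp_all add: relpow_add relpow_commute[symmetric] add.commute[of m])

lemma relpow_split:
  "(a, c) \<in> R ^^ (m + n) \<Longrightarrow> \<exists>b. (a, b) \<in> R ^^ m \<and> (b, c) \<in> R ^^ n"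
  by (auto simp: relpow_add)

lemma relpow_segment:
  assumes "\<forall>i<n. (f i, f (Suc i)) \<in> R" "i \<le> j" "j \<le> n"
  shows "(f i, f j) \<in> R ^^ (j - i)"
proof -
  have "(f (i + 0), f (i + (j - i))) \<in> R ^^ (j - i)"
    unfolding relpow_fun_conv
    by (rule exI[of _ "\<lambda>l. f (i + l)"]) (use assms in auto)
  then show ?thesis using assms by simp
qed

lemma relpow_closed:
  assumes "\<And>a b. a \<in> W \<Longrightarrow> (a, b) \<in> Q \<Longrightarrow> b \<in> W" "a \<in> W" "(a, b) \<in> Q ^^ n"
  shows "b \<in> W"
  using assms(3)
proof (induction n arbitrary: b)
  case 0 then show ?case using assms(2) by simp
next
  case (Suc n) then show ?case using assms(1) by (auto elim!: relpow_Suc_E)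
qed

text \<open>A repeated node could be cut out, and an earlier visit to \<open>Z\<close> would end the
  walk sooner; both contradict minimality over all of \<open>Z\<close>.\<close>

lemma shortest_walk_inj:
  assumes f: "\<forall>i<s. (f i, f (Suc i)) \<in> Q" and z: "f s \<in> Z"
    and min: "\<And>s' z. z \<in> Z \<Longrightarrow> (f 0, z) \<in> Q ^^ s' \<Longrightarrow> s \<le> s'"
  shows "inj_on f {0..s}" "\<forall>i<s. f i \<notin> Z"
proof -
  have "f i \<noteq> f j" if "i < j" "j \<le> s" for i j
  proof
    assume eq: "f i = f j"
    have "(f 0, f i) \<in> Q ^^ i" using relpow_segment[OF f, of 0 i] that by simp
    moreover have "(f j, f s) \<in> Q ^^ (s - j)" using relpow_segment[OF f, of j s] that by simp
    ultimately have "(f 0, f s) \<in> Q ^^ (i + (s - j))" using eq by (metis relpow_trans)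
    from min[OF z this] that show False by simp
  qed
  then show "inj_on f {0..s}"
    by (metis (no_types, lifting) atLeastAtMost_iff inj_onI linorder_neqE_nat)
  show "\<forall>i<s. f i \<notin> Z"
  proof (intro allI impI notI)
    fix i assume i: "i < s" "f i \<in> Z"
    have "(f 0, f i) \<in> Q ^^ i" using relpow_segment[OF f, of 0 i] i by simp
    from min[OF i(2) this] i show False by simp
  qed
qed

text \<open>Before its last node, a shortest walk into \<open>Z\<close> visits distinct nodes of
  \<open>W - Z\<close>.\<close>

lemma reach_set_bound:
  assumes fin: "finite W" and closed: "\<And>a b. a \<in> W \<Longrightarrow> (a, b) \<in> Q \<Longrightarrow> b \<in> W"
    and a: "a \<in> W" and Z: "Z \<subseteq> W" and reach: "z0 \<in> Z" "(a, z0) \<in> Q ^^ s0"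
  shows "\<exists>s z. s \<le> card W - card Z \<and> z \<in> Z \<and> (a, z) \<in> Q ^^ s"
proof -
  define s where "s = (LEAST s. \<exists>z\<in>Z. (a, z) \<in> Q ^^ s)"
  have "\<exists>z\<in>Z. (a, z) \<in> Q ^^ s"
    unfolding s_def by (rule LeastI[of _ s0]) (use reach in auto)
  then obtain z where z: "z \<in> Z" "(a, z) \<in> Q ^^ s" by blast
  have min: "s \<le> s'" if "z \<in> Z" "(a, z) \<in> Q ^^ s'" for s' z
    unfolding s_def by (rule Least_le) (use that in auto)
  obtain f where f: "f 0 = a" "f s = z" "\<forall>i<s. (f i, f (Suc i)) \<in> Q"
    using z(2) unfolding relpow_fun_conv by blast
  have inj: "inj_on f {0..s}" and out: "\<forall>i<s. f i \<notin> Z"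
    using shortest_walk_inj[OF f(3), of Z] z(1) min f(1,2) by auto
  have W: "f i \<in> W" if "i \<le> s" for i
  proof -
    have "(a, f i) \<in> Q ^^ i" using relpow_segment[OF f(3), of 0 i] f(1) that by simp
    with closed a show ?thesis by (rule relpow_closed)
  qed
  have "card (f ` {0..<s}) \<le> card (W - Z)"
    by (rule card_mono) (use fin W out in auto)
  moreover have "card (f ` {0..<s}) = s"
    by (subst card_image) (auto intro: inj_on_subset[OF inj])
  moreover have "card (W - Z) = card W - card Z"
    using Z fin by (simp add: card_Diff_subset finite_subset)
  ultimately show ?thesis using z by auto
qed

text \<open>Let \<open>m = card W\<close>, let \<open>p\<close> be the girth and \<open>Z\<close>
  the set of nodes with a closed walk of length \<open>p\<close>; a shortest closed walk shows
  \<open>card Z \<ge> p\<close>. From any node some \<open>y\<close> in \<open>Z\<close> is reached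
  in exactly \<open>m - p\<close> steps, idling inside \<open>Z\<close> if necessary. Under
  \<open>Q ^^ p\<close> the node \<open>y\<close> has a loop, so \<open>b\<close> is reached from it
  in exactly \<open>m - 1\<close> such steps, idling at \<open>y\<close>. If
  \<open>m \<ge> 2\<close> then \<open>p \<le> m - 1\<close>, and the total is at most Wielandt's
  number.\<close>

theorem wielandt_bound:
  assumes fin: "finite W" and closed: "\<And>a b. a \<in> W \<Longrightarrow> (a, b) \<in> Q \<Longrightarrow> b \<in> W"
    and prim: "\<And>a b. a \<in> W \<Longrightarrow> b \<in> W \<Longrightarrow> \<exists>N. \<forall>e\<ge>N. (a, b) \<in> Q ^^ e"
    and a: "a \<in> W" and b: "b \<in> W" and e: "e \<ge> Wi (card W)"
  shows "(a, b) \<in> Q ^^ e"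
proof -
  define m where "m = card W"
  have m: "m > 0" using fin a by (auto simp: m_def card_gt_0_iff)
  have clos: "y \<in> W" if "x \<in> W" "(x, y) \<in> Q ^^ i" for x y i
    using closed that by (rule relpow_closed)
  have reach: "\<exists>s>0. (x, y) \<in> Q ^^ s" if x: "x \<in> W" and y: "y \<in> W" for x y
  proof -
    obtain N where N: "\<forall>e\<ge>N. (x, y) \<in> Q ^^ e" using prim[OF x y] by blast
    have "(x, y) \<in> Q ^^ Suc N" by (rule N[rule_format]) simp
    then show ?thesis by blast
  qed
  have succ: "\<exists>y\<in>W. (x, y) \<in> Q" if x: "x \<in> W" for x
  proof -
    obtain s where "s > 0" "(x, x) \<in> Q ^^ s" using reach[OF x x] by blast
    then obtain y where "(x, y) \<in> Q" 
      by (metis not0_implies_Suc not_gr0 relpow_Suc_D2)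
    then show ?thesis using closed[OF x] by blast
  qed
  have extend: "\<exists>y\<in>W. (x, y) \<in> Q ^^ i" if x: "x \<in> W" for x i
  proof (induction i)
    case 0 then show ?case using x by auto
  next
    case (Suc i) then show ?case using succ by (meson relpow_Suc_I)
  qed
  define P where "P p \<longleftrightarrow> p > 0 \<and> (\<exists>z\<in>W. (z, z) \<in> Q ^^ p)" for p
  define p where "p = (LEAST p. P p)"
  have p: "p > 0 \<and> (\<exists>z\<in>W. (z, z) \<in> Q ^^ p)"
  proof -
    obtain s where "s > 0" "(a, a) \<in> Q ^^ s" using reach[OF a a] by blast
    then have "P s" using a by (auto simp: P_def)
    then have "P p" unfolding p_def by (rule LeastI)
    then show ?thesis by (simp add: P_def)
  qed
  have girth: "p \<le> i" if "i > 0" "z \<in> W" "(z, z) \<in> Q ^^ i" for i z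
    unfolding p_def by (rule Least_le) (use that in \<open>auto simp: P_def\<close>)
  define Z where "Z = {z \<in> W. (z, z) \<in> Q ^^ p}"
  have ZW: "Z \<subseteq> W" by (auto simp: Z_def)
  then have finZ: "finite Z" using fin finite_subset by blast
  \<comment> \<open>Rotating a closed walk of length \<open>p\<close> by one arc shows that its next
    node is in \<open>Z\<close> as well; this is what permits idling in \<open>Z\<close>.\<close>
  have step: "\<exists>y\<in>Z. (z, y) \<in> Q \<and> (y, z) \<in> Q ^^ (p - 1)" if z: "z \<in> Z" for z
  proof -
    have "(z, z) \<in> Q ^^ Suc (p - 1)" using z p by (simp add: Z_def)
    then obtain y where y: "(z, y) \<in> Q" "(y, z) \<in> Q ^^ (p - 1)" by (blast dest: relpow_Suc_D2)
    then have "(y, y) \<in> Q ^^ Suc (p - 1)" by (meson relpow_Suc_I)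
    moreover have "y \<in> W" using closed[OF _ y(1)] z ZW by blast
    ultimately have "y \<in> Z" using p by (simp add: Z_def)
    with y show ?thesis by blast
  qed
  have stay: "\<exists>y\<in>Z. (z, y) \<in> Q ^^ i" if z: "z \<in> Z" for z i
  proof (induction i)
    case 0 then show ?case using z by auto
  next
    case (Suc i) then show ?case using step by (meson relpow_Suc_I)
  qed
  obtain z0 where z0: "z0 \<in> W" "(z0, z0) \<in> Q ^^ p" using p by blast
  have cardZ: "p \<le> card Z"
  proof -
    obtain f where f: "f 0 = z0" "f p = z0" "\<forall>i<p. (f i, f (Suc i)) \<in> Q"
      using z0(2) unfolding relpow_fun_conv by blast
    have fW: "f i \<in> W" if "i \<le> p" for i
      using clos[OF z0(1), of "f i" i] relpow_segment[OF f(3), of 0 i] f(1) that by auto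
    have "f i \<noteq> f j" if "i < j" "j < p" for i j
    proof
      assume eq: "f i = f j"
      have "(f i, f i) \<in> Q ^^ (j - i)" using relpow_segment[OF f(3), of i j] that eq by simp
      then have "p \<le> j - i" using girth[of "j - i" "f i"] fW[of i] that by simp
      then show False using that by simp
    qed
    then have "inj_on f {0..<p}"
      by (metis (no_types, lifting) atLeastLessThan_iff inj_onI linorder_neqE_nat)
    then have "card (f ` {0..<p}) = p" by (simp add: card_image)
    moreover have "f i \<in> Z" if "i < p" for i
    proof -
      have "(f i, z0) \<in> Q ^^ (p - i)" "(z0, f i) \<in> Q ^^ i"
        using relpow_segment[OF f(3), of i p] relpow_segment[OF f(3), of 0 i] f(1,2) that by auto
      then have "(f i, f i) \<in> Q ^^ (p - i + i)" by (rule relpow_trans)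
      then show ?thesis using fW[of i] that by (simp add: Z_def)
    qed
    then have "f ` {0..<p} \<subseteq> Z" by auto
    then have "card (f ` {0..<p}) \<le> card Z" by (rule card_mono[OF finZ])
    ultimately show ?thesis by simp
  qed
  have cardZm: "card Z \<le> m" unfolding m_def by (rule card_mono[OF fin ZW])
  text \<open>If the girth were \<open>m \<ge> 2\<close>, every shortest walk closing a cycle would be Hamiltonian, so
    no node could have two successors; but then \<open>Q\<close> would be a permutation, hence not primitive.\<close>
  have girth_less: "p < m" if m2: "m \<ge> 2"
  proof (rule ccontr)
    assume "\<not> p < m"
    have unique: "y = y'" if x: "x \<in> W" and y: "(x, y) \<in> Q" "(x, y') \<in> Q" for x y y'
    proof (rule ccontr)
      assume neq: "y \<noteq> y'"
      have yW: "y \<in> W" "y' \<in> W" using closed[OF x y(1)] closed[OF x y(2)] .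
      obtain s0 where s0: "(y, x) \<in> Q ^^ s0" using reach[OF yW(1) x] by blast
      define s where "s = (LEAST s. (y, x) \<in> Q ^^ s)"
      have s: "(y, x) \<in> Q ^^ s" unfolding s_def using s0 by (rule LeastI)
      have mins: "s \<le> s'" if "(y, x) \<in> Q ^^ s'" for s'
        unfolding s_def using that by (rule Least_le)
      obtain f where f: "f 0 = y" "f s = x" "\<forall>i<s. (f i, f (Suc i)) \<in> Q"
        using s unfolding relpow_fun_conv by blast
      have inj: "inj_on f {0..s}"
        using shortest_walk_inj(1)[OF f(3), of "{x}"] mins f(1,2) by auto
      have fW: "f i \<in> W" if "i \<le> s" for i
        using clos[OF yW(1), of "f i" i] relpow_segment[OF f(3), of 0 i] f(1) that by auto
      have "(x, x) \<in> Q ^^ Suc s" using y(1) s by (rule relpow_Suc_I2)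
      then have "p \<le> Suc s" using girth x by blast
      have sub: "f ` {0..s} \<subseteq> W" using fW by auto
      have cardf: "card (f ` {0..s}) = Suc s" using inj by (simp add: card_image)
      have "card (f ` {0..s}) \<le> m" unfolding m_def by (rule card_mono[OF fin sub])
      then have sm: "Suc s = m" using cardf \<open>p \<le> Suc s\<close> \<open>\<not> p < m\<close> by simp
      then have "f ` {0..s} = W" using card_subset_eq[OF fin sub] cardf m_def by simp
      then obtain i where i: "i \<le> s" "f i = y'" using yW(2) by auto
      then have "i > 0" using f(1) neq by (cases i) auto
      have "(y', x) \<in> Q ^^ (s - i)" using relpow_segment[OF f(3), of i s] i f(2) by simp
      with y(2) have "(x, x) \<in> Q ^^ Suc (s - i)" by (rule relpow_Suc_I2)
      then have "p \<le> Suc (s - i)" using girth x by blast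
      then show False using \<open>i > 0\<close> i sm \<open>\<not> p < m\<close> by simp
    qed
    have uniq: "y = y'" if "x \<in> W" "(x, y) \<in> Q ^^ i" "(x, y') \<in> Q ^^ i" for x y y' i
      using that(2,3)
    proof (induction i arbitrary: y y')
      case 0 then show ?case by simp
    next
      case (Suc i)
      then obtain r r' where "(x, r) \<in> Q ^^ i" "(r, y) \<in> Q" "(x, r') \<in> Q ^^ i" "(r', y') \<in> Q"
        by (meson relpow_Suc_E)
      then show ?case using Suc.IH[of r r'] unique[of r y y'] clos[OF that(1), of r i] by simp
    qed
    have "\<not> W \<subseteq> {a}"
    proof
      assume "W \<subseteq> {a}"
      then have "card W \<le> card {a}" by (intro card_mono) auto
      then show False using m2 by (simp add: m_def)
    qed
    then obtain c where c: "c \<in> W" "c \<noteq> a" by blast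
    obtain N where N: "\<forall>e\<ge>N. (a, a) \<in> Q ^^ e" using prim[OF a a] by blast
    obtain N' where N': "\<forall>e\<ge>N'. (a, c) \<in> Q ^^ e" using prim[OF a c(1)] by blast
    have "(a, a) \<in> Q ^^ (N + N')" by (rule N[rule_format]) simp
    moreover have "(a, c) \<in> Q ^^ (N + N')" by (rule N'[rule_format]) simp
    ultimately have "(a, a) \<in> Q ^^ (N + N')" "(a, c) \<in> Q ^^ (N + N')" .
    from uniq[OF a this] c(2) show False by simp
  qed
  define e0 where "e0 = (m - p) + p * (m - 1)"
  have "p \<le> m" using cardZ cardZm by simp
  have e0: "e0 \<le> Wi m"
  \<comment> \<open>A single node has girth 1 and \<open>e0 = 0\<close>. Otherwise
    \<open>e0 = m + p * (m - 2)\<close> is nondecreasing in \<open>p\<close>, and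
    \<open>p = m - 1\<close> gives \<open>(m - 1)^2 + 1\<close>.\<close>
  proof (cases "m = 1")
    case True
    then show ?thesis using \<open>p \<le> m\<close> p by (simp add: e0_def Wi_def)
  next
    case False
    then have "m \<ge> 2" using m by simp
    define r where "r = m - 2"
    have mr: "m = r + 2" using \<open>m \<ge> 2\<close> by (simp add: r_def)
    have pr: "p \<le> r + 1" using girth_less[OF \<open>m \<ge> 2\<close>] mr by simp
    have "e0 = r + 2 + p * r" using pr by (simp add: e0_def mr algebra_simps)
    also have "\<dots> \<le> r + 2 + (r + 1) * r" using pr by (intro add_left_mono mult_right_mono) auto
    also have "\<dots> = Wi m" by (simp add: Wi_def mr power2_eq_square algebra_simps)
    finally show ?thesis .
  qed
  have main: "(x, b) \<in> Q ^^ e0" if x: "x \<in> W" for x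
  proof -
    have z0Z: "z0 \<in> Z" using z0 by (simp add: Z_def)
    obtain s0 where "(x, z0) \<in> Q ^^ s0" using reach[OF x z0(1)] by blast
    with fin closed x ZW z0Z have "\<exists>s z. s \<le> card W - card Z \<and> z \<in> Z \<and> (x, z) \<in> Q ^^ s"
      by (rule reach_set_bound)
    then obtain s z where s: "s \<le> card W - card Z" "z \<in> Z" "(x, z) \<in> Q ^^ s" by blast
    then have sp: "s \<le> m - p" using cardZ by (simp add: m_def)
    obtain y where y: "y \<in> Z" "(z, y) \<in> Q ^^ (m - p - s)" using stay[OF s(2)] by blast
    have "s + (m - p - s) = m - p" using sp by simp
    with relpow_trans[OF s(3) y(2)] have xy: "(x, y) \<in> Q ^^ (m - p)" by (simp only:)
    have yW: "y \<in> W" using y ZW by blast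
    have loop: "(y, y) \<in> (Q ^^ p) ^^ i" for i
      by (induction i) (use y(1) in \<open>auto simp: Z_def intro: relcompI\<close>)
    obtain N where N: "\<forall>e\<ge>N. (y, b) \<in> Q ^^ e" using prim[OF yW b] by blast
    \<comment> \<open>The length is chosen as a multiple of \<open>p\<close>, so that the walk is
      also one for \<open>Q ^^ p\<close>.\<close>
    have "(y, b) \<in> Q ^^ (p * N)" by (rule N[rule_format]) (use p in simp)
    then have yb: "(y, b) \<in> (Q ^^ p) ^^ N" by (simp add: relpow_relpow)
    have "\<exists>s z. s \<le> card W - card {b} \<and> z \<in> {b} \<and> (y, z) \<in> (Q ^^ p) ^^ s"
    proof (rule reach_set_bound[OF fin _ yW _ _ yb])
      show "u' \<in> W" if "u \<in> W" "(u, u') \<in> Q ^^ p" for u u' using clos[OF that] .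
    qed (use b in auto)
    then obtain s' where s': "s' \<le> m - 1" "(y, b) \<in> (Q ^^ p) ^^ s'" by (auto simp: m_def)
    have "(y, b) \<in> (Q ^^ p) ^^ (m - 1 - s' + s')" by (rule relpow_trans[OF loop s'(2)])
    moreover have "m - 1 - s' + s' = m - 1" using s'(1) by simp
    ultimately have "(y, b) \<in> Q ^^ (p * (m - 1))" by (simp only: relpow_relpow)
    then show ?thesis unfolding e0_def by (rule relpow_trans[OF xy])
  qed
  \<comment> \<open>\<open>main\<close> works from every node of \<open>W\<close>, so the surplus
    steps are spent at the start on arbitrary arcs.\<close>
  obtain x where "x \<in> W" "(a, x) \<in> Q ^^ (e - e0)" using extend[OF a] by blast
  then have "(a, b) \<in> Q ^^ (e - e0 + e0)" using main[of x] by (meson relpow_trans)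
  moreover have "e - e0 + e0 = e" using e e0 by (simp add: m_def)
  ultimately show ?thesis by (simp only:)
qed

section \<open>Cyclic classes and Schwarz's bound\<close>

lemma Wi_mono: "m \<le> m' \<Longrightarrow> Wi m \<le> Wi m'"
  by (auto simp: Wi_def power_mono)

text \<open>Multiplied by \<open>\<gamma>\<close>, the gain of 1 pays for the fewer than
  \<open>\<gamma>\<close> arcs that lead into a cyclic class in
  \<open>schwarz_bound\<close>.\<close>

lemma Wi_less: "c > 0 \<Longrightarrow> c < m \<Longrightarrow> Wi c + 1 \<le> Wi m"
proof -
  assume "c > 0" "c < m"
  then have "(c - 1)\<^sup>2 < (m - 1)\<^sup>2" by (intro power_strict_mono) auto
  then show ?thesis using \<open>c > 0\<close> \<open>c < m\<close> by (simp add: Wi_def)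
qed

text \<open>Instantiated twice with the same \<open>\<gamma>\<close>, for the critical digraph and
  for the full one; the shared parameter is how the equality of the cyclicities enters.\<close>

locale cyclic_relation =
  fixes V :: "'a set" and R :: "('a \<times> 'a) set" and \<gamma> :: nat
  assumes finite_V: "finite V"
    and R_sub: "R \<subseteq> V \<times> V"
    and connected: "a \<in> V \<Longrightarrow> b \<in> V \<Longrightarrow> (a, b) \<in> R\<^sup>*"
    and nonempty: "R \<noteq> {}"
    and period: "\<gamma> = Gcd {l. l > 0 \<and> (\<exists>a\<in>V. (a, a) \<in> R ^^ l)}"
begin

lemma walk_ex: "a \<in> V \<Longrightarrow> b \<in> V \<Longrightarrow> \<exists>m. (a, b) \<in> R ^^ m"
  using connected rtrancl_imp_relpow by blast

lemma relpow_in: "a \<in> V \<Longrightarrow> (a, b) \<in> R ^^ m \<Longrightarrow> b \<in> V"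
  using relpow_closed[of V R a b m] R_sub by blast

lemma succ: "a \<in> V \<Longrightarrow> \<exists>b\<in>V. (a, b) \<in> R"
proof -
  assume a: "a \<in> V"
  obtain x y where xy: "(x, y) \<in> R" using nonempty by auto
  then have "x \<in> V" using R_sub by auto
  from connected[OF a this] xy have "(a, y) \<in> R\<^sup>+" by (rule rtrancl_into_trancl1)
  then obtain b where "(a, b) \<in> R" by (meson tranclD)
  then show ?thesis using R_sub by auto
qed

lemma pred: "a \<in> V \<Longrightarrow> \<exists>b\<in>V. (b, a) \<in> R"
proof -
  assume a: "a \<in> V"
  obtain x y where xy: "(x, y) \<in> R" using nonempty by auto
  then have "y \<in> V" using R_sub by auto
  from xy connected[OF this a] have "(x, a) \<in> R\<^sup>+" by (rule rtrancl_into_trancl2)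
  then obtain b where "(b, a) \<in> R" by (meson tranclD2)
  then show ?thesis using R_sub by auto
qed

lemma succs: "a \<in> V \<Longrightarrow> \<exists>b\<in>V. (a, b) \<in> R ^^ i"
proof (induction i)
  case 0 then show ?case by auto
next
  case (Suc i) then show ?case using succ by (meson relpow_Suc_I)
qed

lemma preds: "a \<in> V \<Longrightarrow> \<exists>b\<in>V. (b, a) \<in> R ^^ i"
proof (induction i)
  case 0 then show ?case by auto
next
  case (Suc i) then show ?case using pred by (meson relpow_Suc_I2)
qed

lemma period_dvd: "a \<in> V \<Longrightarrow> (a, a) \<in> R ^^ l \<Longrightarrow> \<gamma> dvd l"
  by (cases "l = 0") (auto simp: period intro!: Gcd_dvd)

lemma period_pos: "\<gamma> > 0"
proof -
  obtain a b where ab: "(a, b) \<in> R" using nonempty by auto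
  then have V: "a \<in> V" "b \<in> V" using R_sub by auto
  obtain m where "(b, a) \<in> R ^^ m" using walk_ex[OF V(2,1)] by blast
  with ab have "(a, a) \<in> R ^^ Suc m" by (rule relpow_Suc_I2)
  then have "\<gamma> dvd Suc m" by (rule period_dvd[OF V(1)])
  then show ?thesis by (cases \<gamma>) auto
qed

text \<open>Closing both walks by the same return walk gives two closed walks, and
  \<open>\<gamma>\<close> divides both lengths.\<close>

lemma walk_length_cong:
  assumes "a \<in> V" "b \<in> V" "(a, b) \<in> R ^^ m" "(a, b) \<in> R ^^ m'"
  shows "m mod \<gamma> = m' mod \<gamma>"
proof -
  obtain s where s: "(b, a) \<in> R ^^ s" using walk_ex assms by blast
  have "\<gamma> dvd m + s" "\<gamma> dvd m' + s"
    using period_dvd[OF assms(1)] relpow_trans[OF assms(3) s] relpow_trans[OF assms(4) s] by auto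
  then have "(m + s) mod \<gamma> = (m' + s) mod \<gamma>" by (simp add: dvd_eq_mod_eq_0)
  then show ?thesis by (metis add.commute cong_add_lcancel_nat cong_def)
qed

text \<open>The period is a gcd over closed walks at all nodes, whereas here only those at
  \<open>a\<close> count. A closed walk of length \<open>c\<close> at \<open>b\<close> is the
  difference of two return lengths of \<open>a\<close>: a detour to \<open>b\<close> with and
  without it. So the gcd at \<open>a\<close> divides \<open>\<gamma>\<close>.\<close>

lemma closed_walks_eventually:
  assumes a: "a \<in> V"
  shows "\<exists>N. \<forall>l\<ge>N. \<gamma> dvd l \<longrightarrow> (a, a) \<in> R ^^ l"
proof -
  define H where "H = {l. (a, a) \<in> R ^^ l}"
  have "Gcd H dvd c" if c: "c > 0" "b \<in> V" "(b, b) \<in> R ^^ c" for b c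
  proof -
    obtain s s' where s: "(a, b) \<in> R ^^ s" "(b, a) \<in> R ^^ s'" using walk_ex a c(2) by blast
    have "s + s' \<in> H" "s + c + s' \<in> H"
      using relpow_trans[OF s] relpow_trans[OF relpow_trans[OF s(1) c(3)] s(2)] by (auto simp: H_def)
    then have "Gcd H dvd s + s'" "Gcd H dvd s + c + s'" by auto
    moreover have "s + c + s' = (s + s') + c" by simp
    ultimately show ?thesis by (metis dvd_add_right_iff)
  qed
  then have "Gcd H dvd \<gamma>" unfolding period by (intro Gcd_greatest) auto
  moreover have "\<exists>N. \<forall>l\<ge>N. Gcd H dvd l \<longrightarrow> l \<in> H"
    by (rule large_multiples_in_additive_set) (auto simp: H_def intro: relpow_trans)
  ultimately show ?thesis unfolding H_def using dvd_trans by blast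
qed

lemma walks_eventually:
  assumes a: "a \<in> V" and w: "(a, b) \<in> R ^^ m"
  shows "\<exists>N. \<forall>l\<ge>N. l mod \<gamma> = m mod \<gamma> \<longrightarrow> (a, b) \<in> R ^^ l"
proof -
  obtain N where N: "\<forall>l\<ge>N. \<gamma> dvd l \<longrightarrow> (a, a) \<in> R ^^ l" using closed_walks_eventually[OF a] by blast
  have "(a, b) \<in> R ^^ l" if l: "l \<ge> N + m" "l mod \<gamma> = m mod \<gamma>" for l
  proof -
    have "\<gamma> dvd l - m" using l by (simp add: mod_eq_dvd_iff_nat)
    then have "(a, a) \<in> R ^^ (l - m)" using N l(1) by simp
    then have "(a, b) \<in> R ^^ (l - m + m)" using w by (rule relpow_trans)
    then show ?thesis using l(1) by simp
  qed
  then show ?thesis by blast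
qed

text \<open>The walk goes \<open>j\<close> arcs into a cyclic class \<open>W j\<close>, then
  \<open>e\<close> times \<open>\<gamma>\<close> arcs between nodes of that class by Wielandt's
  bound, then the remaining \<open>d < \<gamma>\<close> arcs to \<open>b\<close>. The point is to
  choose the class so that \<open>j + \<gamma> * Wi (card (W j))\<close> is at most
  \<open>Sch \<gamma> (card V)\<close>.\<close>

theorem schwarz_bound:
  assumes a: "a \<in> V" and w: "(a, b) \<in> R ^^ m0"
    and l: "l \<ge> Sch \<gamma> (card V)" "l mod \<gamma> = m0 mod \<gamma>"
  shows "(a, b) \<in> R ^^ l"
proof -
  have b: "b \<in> V" using relpow_in[OF a w] .
  define W where "W j = {c \<in> V. \<exists>r. (a, c) \<in> R ^^ r \<and> r mod \<gamma> = j}" for j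
  define m s where "m = card V div \<gamma>" and "s = card V mod \<gamma>"
  have s: "s < \<gamma>" using period_pos by (simp add: s_def)
  have q: "card V = \<gamma> * m + s" by (simp add: m_def s_def)
  have finW: "finite (W j)" for j using finite_V by (simp add: W_def)
  have Wne: "W j \<noteq> {}" if "j < \<gamma>" for j
  proof -
    obtain c where "c \<in> V" "(a, c) \<in> R ^^ j" using succs[OF a] by blast
    then show ?thesis using that by (auto simp: W_def intro!: exI[of _ c] exI[of _ j])
  qed
  have V: "V = (\<Union>j<\<gamma>. W j)"
    using walk_ex[OF a] period_pos by (fastforce simp: W_def)
  have "card V = (\<Sum>j<\<gamma>. card (W j))"
    unfolding V by (rule card_UN_disjoint) (use finW walk_length_cong[OF a] in \<open>auto simp: W_def\<close>)
  \<comment> \<open>If no class were small enough, the \<open>s + 1\<close> classes with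
    \<open>j \<le> s\<close> would have more than \<open>m\<close> nodes each and the others at
    least \<open>m\<close>, which is one node too many.\<close>
  moreover have "\<gamma> * m + s < (\<Sum>j<\<gamma>. card (W j))"
    if large: "\<forall>j<\<gamma>. m \<le> card (W j)" "\<forall>j\<le>s. m < card (W j)"
  proof -
    have "(\<Sum>j<\<gamma>. m + (if j \<le> s then 1 else 0)) \<le> (\<Sum>j<\<gamma>. card (W j))"
      by (rule sum_mono) (use large in auto)
    moreover have "(\<Sum>j<\<gamma>. if j \<le> s then 1 else 0) = card {j. j < \<gamma> \<and> j \<le> s}"
      by (simp add: sum.If_cases lessThan_def Int_def)
    moreover have "{j. j < \<gamma> \<and> j \<le> s} = {..s}" using s by auto
    ultimately show ?thesis by (simp add: sum.distrib)
  qed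
  ultimately have "\<not> ((\<forall>j<\<gamma>. m \<le> card (W j)) \<and> (\<forall>j\<le>s. m < card (W j)))"
    using q by auto
  then obtain j where j: "j < \<gamma>" "card (W j) < m \<or> (j \<le> s \<and> card (W j) \<le> m)"
    using s by (meson le_less_trans not_le)
  define e where "e = (l - j) div \<gamma>"
  define d where "d = (l - j) mod \<gamma>"
  have Wpos: "card (W j) > 0" using Wne[OF j(1)] finW by (simp add: card_gt_0_iff)
  \<comment> \<open>A class with fewer than \<open>m\<close> nodes saves a full
    \<open>\<gamma>\<close> by \<open>Wi_less\<close>, which pays for \<open>j < \<gamma>\<close>; a
    class with \<open>j \<le> s\<close> is paid for by the summand
    \<open>card V mod \<gamma>\<close> of Schwarz's number.\<close>
  have "j \<le> l \<and> \<gamma> * Wi (card (W j)) \<le> l - j"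
  proof (cases "card (W j) < m")
    case True
    have "Wi (card (W j)) + 1 \<le> Wi m" by (rule Wi_less[OF Wpos True])
    then have "\<gamma> * (Wi (card (W j)) + 1) \<le> \<gamma> * Wi m" by (rule mult_le_mono2)
    then show ?thesis using l(1) j(1) by (simp add: Sch_def m_def[symmetric])
  next
    case False
    then have "Wi (card (W j)) \<le> Wi m" and js: "j \<le> s" using j(2) Wi_mono by auto
    from mult_le_mono2[OF this(1), of \<gamma>] have "\<gamma> * Wi (card (W j)) \<le> \<gamma> * Wi m" .
    moreover have "\<gamma> * Wi m + s \<le> l" using l(1) by (simp add: Sch_def m_def s_def)
    ultimately show ?thesis using js by linarith
  qed
  then have jl: "j \<le> l" and e: "Wi (card (W j)) \<le> e"
    using period_pos by (auto simp: e_def less_eq_div_iff_mult_less_eq mult.commute)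
  have le: "l = j + \<gamma> * e + d"
    using jl by (simp add: e_def d_def)
  obtain c where c: "c \<in> V" "(a, c) \<in> R ^^ j" using succs[OF a] by blast
  \<comment> \<open>\<open>c'\<close> is any node \<open>d\<close> arcs before \<open>b\<close>; the
    residue of \<open>l\<close> forces it into the same class \<open>W j\<close> as
    \<open>c\<close>.\<close>
  obtain c' where c': "c' \<in> V" "(c', b) \<in> R ^^ d" using preds[OF b] by blast
  have cW: "c \<in> W j" using c j(1) by (auto simp: W_def)
  have c'W: "c' \<in> W j"
  proof -
    obtain r where r: "(a, c') \<in> R ^^ r" using walk_ex[OF a c'(1)] by blast
    have "(r + d) mod \<gamma> = m0 mod \<gamma>"
      by (rule walk_length_cong[OF a b relpow_trans[OF r c'(2)] w])
    also have "\<dots> = ((j + d) + \<gamma> * e) mod \<gamma>" using l(2) le by (simp only: ac_simps)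
    also have "\<dots> = (j + d) mod \<gamma>" by simp
    finally have "r mod \<gamma> = j mod \<gamma>"
      by (metis add.commute cong_add_lcancel_nat cong_def)
    then show ?thesis using r c'(1) j(1) by (auto simp: W_def)
  qed
  have "(c, c') \<in> (R ^^ \<gamma>) ^^ e"
  proof (rule wielandt_bound[OF finW _ _ cW c'W e])
    show "y \<in> W j" if x: "x \<in> W j" and xy: "(x, y) \<in> R ^^ \<gamma>" for x y
    proof -
      obtain r where r: "(a, x) \<in> R ^^ r" "r mod \<gamma> = j" "x \<in> V" using x by (auto simp: W_def)
      have "(a, y) \<in> R ^^ (r + \<gamma>)" "(r + \<gamma>) mod \<gamma> = j" "y \<in> V"
        using relpow_trans[OF r(1) xy] r(2) relpow_in[OF r(3) xy] by auto
      then show ?thesis unfolding W_def by blast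
    qed
    show "\<exists>N. \<forall>e\<ge>N. (x, y) \<in> (R ^^ \<gamma>) ^^ e" if xy: "x \<in> W j" "y \<in> W j" for x y
    proof -
      obtain r r' where r: "(a, x) \<in> R ^^ r" "r mod \<gamma> = j" "x \<in> V"
        and r': "(a, y) \<in> R ^^ r'" "r' mod \<gamma> = j" "y \<in> V" using xy by (auto simp: W_def)
      obtain i where i: "(x, y) \<in> R ^^ i" using walk_ex[OF r(3) r'(3)] by blast
      have "(r + i) mod \<gamma> = (r + 0) mod \<gamma>"
        using walk_length_cong[OF a r'(3) relpow_trans[OF r(1) i] r'(1)] r(2) r'(2) by simp
      then have i0: "i mod \<gamma> = 0" by (metis cong_add_lcancel_nat cong_def mod_0)
      obtain N where N: "\<forall>l\<ge>N. l mod \<gamma> = i mod \<gamma> \<longrightarrow> (x, y) \<in> R ^^ l"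
        using walks_eventually[OF r(3) i] by blast
      have "(x, y) \<in> (R ^^ \<gamma>) ^^ e" if "e \<ge> N" for e
      proof -
        have "e \<le> \<gamma> * e" using period_pos by simp
        with that have "N \<le> \<gamma> * e" by (rule le_trans)
        then show ?thesis using N i0 by (simp add: relpow_relpow)
      qed
      then show ?thesis by blast
    qed
  qed
  then have "(c, c') \<in> R ^^ (\<gamma> * e)" by (simp add: relpow_relpow)
  then show ?thesis unfolding le using c(2) c'(2) by (blast intro: relpow_trans)
qed

end

section \<open>Max-plus products and walk weights\<close>

lemma trop_mult_ge: "A $ i $ l + B $ l $ j \<le> (A \<otimes> B) $ i $ j"
  by (auto simp: trop_mult_def intro!: Max_ge)

lemma trop_mult_attained: "\<exists>l. (A \<otimes> B) $ i $ j = A $ i $ l + B $ l $ j"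
proof -
  have "(MAX l\<in>UNIV. A $ i $ l + B $ l $ j) \<in> range (\<lambda>l. A $ i $ l + B $ l $ j)"
    by (rule Max_in) auto
  then obtain l where "(MAX l\<in>UNIV. A $ i $ l + B $ l $ j) = A $ i $ l + B $ l $ j"
    by (rule imageE)
  then show ?thesis by (auto simp: trop_mult_def)
qed

lemma trop_prod_Nil [simp]: "trop_prod [] = trop_id"
  and trop_prod_Cons [simp]: "trop_prod (A # As) = A \<otimes> trop_prod As"
  by (simp_all add: trop_prod_def)

lemma trop_prod_nonpos:
  "(\<And>A i j. A \<in> set As \<Longrightarrow> A $ i $ j \<le> 0) \<Longrightarrow> trop_prod As $ i $ j \<le> 0"
proof (induction As arbitrary: i)
  case Nil then show ?case by (simp add: trop_id_def)
next
  case (Cons A As)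
  obtain l where l: "trop_prod (A # As) $ i $ j = A $ i $ l + trop_prod As $ l $ j"
    using trop_mult_attained[of A "trop_prod As" i j] by auto
  have "A $ i $ l \<le> 0" "trop_prod As $ l $ j \<le> 0" using Cons by auto
  then show ?case unfolding l by (metis add_nonpos_nonpos)
qed

text \<open>In \<open>ereal\<close> the sum of \<open>-\<infinity>\<close> and
  \<open>\<infinity>\<close> is \<open>\<infinity>\<close>. The sign condition on \<open>Bs\<close>
  rules this out where the identity matrix contributes \<open>-\<infinity>\<close>.\<close>

lemma trop_prod_append_ge:
  assumes "\<And>B i j. B \<in> set Bs \<Longrightarrow> B $ i $ j \<le> 0"
  shows "trop_prod As $ i $ l + trop_prod Bs $ l $ j \<le> trop_prod (As @ Bs) $ i $ j"
proof (induction As arbitrary: i)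
  case Nil
  have "trop_prod Bs $ l $ j \<le> 0" using assms by (rule trop_prod_nonpos)
  then show ?case by (cases "trop_prod Bs $ l $ j") (auto simp: trop_id_def)
next
  case (Cons A As)
  obtain m where m: "trop_prod (A # As) $ i $ l = A $ i $ m + trop_prod As $ m $ l"
    using trop_mult_attained[of A "trop_prod As" i l] by auto
  have "trop_prod (A # As) $ i $ l + trop_prod Bs $ l $ j
      = A $ i $ m + (trop_prod As $ m $ l + trop_prod Bs $ l $ j)"
    unfolding m by (simp add: add.assoc)
  also have "\<dots> \<le> A $ i $ m + trop_prod (As @ Bs) $ m $ j" by (intro add_left_mono Cons.IH)
  also have "\<dots> \<le> trop_prod ((A # As) @ Bs) $ i $ j" by (simp add: trop_mult_ge)
  finally show ?case .
qed

lemma trop_prod_zero_walk: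
  assumes "\<And>A x y. A \<in> set As \<Longrightarrow> (x, y) \<in> R \<Longrightarrow> A $ x $ y = 0"
    and "(a, b) \<in> R ^^ length As"
  shows "0 \<le> trop_prod As $ a $ b"
  using assms
proof (induction As arbitrary: a)
  case Nil then show ?case by (simp add: trop_id_def)
next
  case (Cons A As)
  have "(a, b) \<in> R ^^ Suc (length As)" using Cons.prems(2) by simp
  then obtain c where c: "(a, c) \<in> R" "(c, b) \<in> R ^^ length As" by (blast dest: relpow_Suc_D2)
  have "0 \<le> trop_prod As $ c $ b" using Cons.IH[OF _ c(2)] Cons.prems(1) by simp
  then have "0 \<le> A $ a $ c + trop_prod As $ c $ b" using Cons.prems(1)[OF _ c(1), of A] by simp
  also have "\<dots> \<le> trop_prod (A # As) $ a $ b" by (simp add: trop_mult_ge)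
  finally show ?case .
qed

text \<open>The weight of a walk on the trellis digraph: the arc at each step is weighed by the
  factor at that step. Surplus matrices or nodes silently contribute 0, so the lemmas relate the
  lengths of \<open>As\<close> and \<open>p\<close>.\<close>

fun trellis_weight :: "'n::finite trop_mat list \<Rightarrow> 'n list \<Rightarrow> ereal" where
  "trellis_weight (A # As) (x # y # p) = A $ x $ y + trellis_weight As (y # p)"
| "trellis_weight _ _ = 0"

lemma trellis_weight_le_prod:
  "length p = Suc (length As) \<Longrightarrow> trellis_weight As p \<le> trop_prod As $ hd p $ last p"
proof (induction As p rule: trellis_weight.induct)
  case (1 A As x y p)
  then have "trellis_weight As (y # p) \<le> trop_prod As $ y $ last (y # p)" by simp
  then have "trellis_weight (A # As) (x # y # p) \<le> A $ x $ y + trop_prod As $ y $ last (y # p)"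
    unfolding trellis_weight.simps by (rule add_left_mono)
  also have "\<dots> \<le> trop_prod (A # As) $ x $ last (y # p)" by (simp add: trop_mult_ge)
  finally show ?case by simp
qed (auto simp: trop_id_def length_Suc_conv)

lemma trop_prod_attained:
  assumes "\<And>A i j. A \<in> set As \<Longrightarrow> A $ i $ j \<le> 0" and "trop_prod As $ i $ j \<noteq> -\<infinity>"
  shows "\<exists>p. length p = Suc (length As) \<and> hd p = i \<and> last p = j
      \<and> trellis_weight As p = trop_prod As $ i $ j"
  using assms
proof (induction As arbitrary: i)
  case Nil
  then show ?case by (intro exI[of _ "[i]"]) (auto simp: trop_id_def split: if_splits)
next
  case (Cons A As)
  obtain l where l: "trop_prod (A # As) $ i $ j = A $ i $ l + trop_prod As $ l $ j"
    using trop_mult_attained[of A "trop_prod As" i j] by auto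
  have "A $ i $ l \<le> 0" using Cons.prems(1) by auto
  with l Cons.prems(2) have "trop_prod As $ l $ j \<noteq> -\<infinity>" by auto
  then obtain p where p: "length p = Suc (length As)" "hd p = l" "last p = j"
      "trellis_weight As p = trop_prod As $ l $ j" using Cons.IH[of l] Cons.prems(1) by auto
  then obtain p' where "p = l # p'" by (cases p) auto
  then show ?case using p l by (intro exI[of _ "i # p"]) auto
qed

lemma trellis_weight_append:
  "length p \<le> length As \<Longrightarrow> trellis_weight As (p @ x # q)
    = trellis_weight (take (length p) As) (p @ [x]) + trellis_weight (drop (length p) As) (x # q)"
proof (induction p arbitrary: As)
  case Nil then show ?case by simp
next
  case (Cons a p)
  then obtain A Bs where As: "As = A # Bs" by (cases As) auto
  then have "trellis_weight Bs (p @ x # q)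
    = trellis_weight (take (length p) Bs) (p @ [x]) + trellis_weight (drop (length p) Bs) (x # q)"
    using Cons by simp
  then show ?case unfolding As by (cases p) (simp_all add: add.assoc)
qed

section \<open>Weights for a single matrix and their comparison with trellis weights\<close>

lemma walk_weight_simps [simp]:
  "walk_weight A [] = 0" "walk_weight A [x] = 0"
  "walk_weight A (x # y # p) = A $ x $ y + walk_weight A (y # p)"
  by (simp_all add: walk_weight_def)

lemma walk_weight_append:
  "walk_weight A (p @ x # q) = walk_weight A (p @ [x]) + walk_weight A (x # q)"
proof (induction p)
  case (Cons a p) then show ?case by (cases p) (simp_all add: add.assoc)
qed simp

lemma trellis_weight_le_walk_weight:
  "(\<And>A i j. A \<in> set As \<Longrightarrow> A $ i $ j \<le> M $ i $ j) \<Longrightarrow> length p = Suc (length As) \<Longrightarrow>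
    trellis_weight As p \<le> walk_weight M p"
  by (induction As p rule: trellis_weight.induct) (auto simp: length_Suc_conv intro!: add_mono)

lemma walk_weight_le_trellis_weight:
  "(\<And>A i j. A \<in> set As \<Longrightarrow> M $ i $ j \<le> A $ i $ j) \<Longrightarrow> length p = Suc (length As) \<Longrightarrow>
    walk_weight M p \<le> trellis_weight As p"
  by (induction As p rule: trellis_weight.induct) (auto simp: length_Suc_conv intro!: add_mono)

lemma walk_weight_nonpos: "(\<And>i j. A $ i $ j \<le> 0) \<Longrightarrow> walk_weight A p \<le> 0"
proof (induction p rule: vwalk_arcs.induct)
  case (3 x y xs)
  then have "A $ x $ y \<le> 0" "walk_weight A (y # xs) \<le> 0" by auto
  then show ?case by (simp add: add_nonpos_nonpos)
qed simp_all

lemma walk_weight_mono: "(\<And>i j. A $ i $ j \<le> B $ i $ j) \<Longrightarrow> walk_weight A p \<le> walk_weight B p"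
  by (induction p rule: vwalk_arcs.induct) (auto intro: add_mono)

lemma trellis_weight_nonpos:
  assumes "\<And>A i j. A \<in> set As \<Longrightarrow> A $ i $ j \<le> 0" and "length p = Suc (length As)"
  shows "trellis_weight As p \<le> 0"
proof -
  have "trellis_weight As p \<le> walk_weight (0 :: _ trop_mat) p"
    by (rule trellis_weight_le_walk_weight) (use assms in auto)
  also have "\<dots> \<le> 0" by (rule walk_weight_nonpos) simp
  finally show ?thesis .
qed

lemma vwalk_arcs_of_weight:
  assumes "\<And>i j. A $ i $ j \<le> 0"
  shows "walk_weight A p \<noteq> -\<infinity> \<longleftrightarrow> set (vwalk_arcs p) \<subseteq> {(i, j). A $ i $ j \<noteq> -\<infinity>}"
proof (induction p rule: vwalk_arcs.induct)
  case (3 x y xs)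
  have "A $ x $ y \<le> 0" "walk_weight A (y # xs) \<le> 0"
    by (rule assms, rule walk_weight_nonpos, rule assms)
  then have "A $ x $ y \<noteq> \<infinity>" "walk_weight A (y # xs) \<noteq> \<infinity>" by auto
  then have "walk_weight A (x # y # xs) \<noteq> -\<infinity> \<longleftrightarrow> A $ x $ y \<noteq> -\<infinity> \<and> walk_weight A (y # xs) \<noteq> -\<infinity>"
    by auto
  then show ?case using 3 by simp
qed simp_all

lemma vwalk_relpow:
  "set (vwalk_arcs p) \<subseteq> R \<Longrightarrow> p \<noteq> [] \<Longrightarrow> (hd p, last p) \<in> R ^^ (length p - 1)"
proof (induction p rule: vwalk_arcs.induct)
  case (3 x y xs)
  then have "(x, y) \<in> R" "(y, last (y # xs)) \<in> R ^^ length xs" by auto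
  then have "(x, last (y # xs)) \<in> R ^^ Suc (length xs)" by (rule relpow_Suc_I2)
  then show ?case by simp
qed simp_all

lemma relpow_vwalk:
  "(a, b) \<in> R ^^ l \<Longrightarrow>
    \<exists>p. length p = Suc l \<and> hd p = a \<and> last p = b \<and> set (vwalk_arcs p) \<subseteq> R"
proof (induction l arbitrary: a)
  case 0 then show ?case by (intro exI[of _ "[a]"]) auto
next
  case (Suc l)
  then obtain c where c: "(a, c) \<in> R" "(c, b) \<in> R ^^ l" by (blast dest: relpow_Suc_D2)
  then obtain p where p: "length p = Suc l" "hd p = c" "last p = b" "set (vwalk_arcs p) \<subseteq> R"
    using Suc.IH by blast
  then have "p \<noteq> []" by auto
  then show ?case using p c(1) by (intro exI[of _ "a # p"]) auto
qed

text \<open>With \<open>\<infinity>\<close> excluded, one missing arc makes the whole sum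
  \<open>-\<infinity>\<close>; so the existence of a walk can be read off its weight.\<close>

lemma vwalk_digraph_iff:
  "(\<And>i j. A $ i $ j \<le> 0) \<Longrightarrow>
    vwalk p (with_proj (digraph_of A)) \<longleftrightarrow> p \<noteq> [] \<and> walk_weight A p \<noteq> -\<infinity>"
  using vwalk_arcs_of_weight[of A p] by (auto simp: vwalk_def digraph_of_def)

section \<open>CSR products expressed by relation powers\<close>

lemma trop_pow_support:
  "trop_pow (support_mat G) l $ a $ b = (if (a, b) \<in> parcs G ^^ l then 0 else -\<infinity>)"
proof (induction l arbitrary: a)
  case 0 then show ?case by (simp add: trop_id_def)
next
  case (Suc l)
  let ?S = "support_mat G" and ?R = "parcs G"
  have S: "?S $ x $ y = (if (x, y) \<in> ?R then 0 else -\<infinity>)" for x y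
    by (simp add: support_mat_def)
  obtain c where c: "trop_pow ?S (Suc l) $ a $ b = ?S $ a $ c + trop_pow ?S l $ c $ b"
    using trop_mult_attained[of ?S "trop_pow ?S l" a b] by auto
  show ?case
  proof (cases "(a, b) \<in> ?R ^^ Suc l")
    case True
    then obtain d where d: "(a, d) \<in> ?R" "(d, b) \<in> ?R ^^ l" by (blast dest: relpow_Suc_D2)
    have "?S $ a $ d + trop_pow ?S l $ d $ b \<le> trop_pow ?S (Suc l) $ a $ b"
      by (simp add: trop_mult_ge)
    then have "0 \<le> trop_pow ?S (Suc l) $ a $ b" using d Suc by (simp add: S)
    moreover have "trop_pow ?S (Suc l) $ a $ b \<le> 0"
      unfolding c by (simp add: S Suc)
    ultimately show ?thesis using True by simp
  next
    case False
    then have "\<not> ((a, c) \<in> ?R \<and> (c, b) \<in> ?R ^^ l)" by (meson relpow_Suc_I2)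
    then show ?thesis using False unfolding c by (auto simp: S Suc)
  qed
qed

lemma trop_pow_support_eq_iff:
  "trop_pow (support_mat G) l = trop_pow (support_mat G) l' \<longleftrightarrow> parcs G ^^ l = parcs G ^^ l'"
proof -
  have "trop_pow (support_mat G) l = trop_pow (support_mat G) l' \<longleftrightarrow>
      (\<forall>a b. (a, b) \<in> parcs G ^^ l \<longleftrightarrow> (a, b) \<in> parcs G ^^ l')"
    by (auto simp: vec_eq_iff trop_pow_support)
  then show ?thesis by auto
qed

lemma double_diff: "r \<le> E \<Longrightarrow> 2 * E - r = (E - r) + r + (E - r)" for r E :: nat
  by simp

text \<open>The three middle factors of \<open>csr\<close> amount to one power of the arc relation,
  of exponent E = 2(t + 1)\<gamma> - k mod \<gamma>. Since E is congruent to -k modulo \<gamma>, two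
  walks of length k joined by a walk of length E have total length congruent to k.\<close>

lemma csr_ge:
  assumes "k mod \<gamma> \<le> (t + 1) * \<gamma>"
    and "(a, b) \<in> parcs G ^^ (2 * ((t + 1) * \<gamma>) - k mod \<gamma>)"
  shows "M $ i $ a + M $ b $ j \<le> csr (support_mat G) \<gamma> t k M $ i $ j"
proof -
  let ?S = "support_mat G"
  define r e where "r = k mod \<gamma>" and "e = (t + 1) * \<gamma> - r"
  have er: "2 * ((t + 1) * \<gamma>) - k mod \<gamma> = e + r + e"
    unfolding e_def r_def by (rule double_diff[OF assms(1)])
  from assms(2) have "(a, b) \<in> parcs G ^^ (e + r + e)" unfolding er .
  from relpow_split[OF this] obtain y where y: "(a, y) \<in> parcs G ^^ (e + r)" "(y, b) \<in> parcs G ^^ e"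
    by blast
  from relpow_split[OF y(1)] obtain x where x: "(a, x) \<in> parcs G ^^ e" "(x, y) \<in> parcs G ^^ r"
    by blast
  note xy = x y(2)
  have "M $ i $ a + 0 \<le> (M \<otimes> trop_pow ?S e) $ i $ x"
    using trop_mult_ge[of M i a "trop_pow ?S e" x] xy(1) by (simp add: trop_pow_support)
  then have "M $ i $ a + 0 + 0 \<le> (M \<otimes> trop_pow ?S e) $ i $ x + trop_pow ?S r $ x $ y"
    using xy(2) by (simp add: trop_pow_support)
  also have "\<dots> \<le> (M \<otimes> trop_pow ?S e \<otimes> trop_pow ?S r) $ i $ y" by (rule trop_mult_ge)
  finally have 1: "M $ i $ a \<le> (M \<otimes> trop_pow ?S e \<otimes> trop_pow ?S r) $ i $ y" by simp
  have 2: "M $ b $ j \<le> (trop_pow ?S e \<otimes> M) $ y $ j"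
    using trop_mult_ge[of "trop_pow ?S e" y b M j] xy(3) by (simp add: trop_pow_support)
  have "M $ i $ a + M $ b $ j
      \<le> (M \<otimes> trop_pow ?S e \<otimes> trop_pow ?S r) $ i $ y + (trop_pow ?S e \<otimes> M) $ y $ j"
    using 1 2 by (rule add_mono)
  also have "\<dots> \<le> csr ?S \<gamma> t k M $ i $ j"
    unfolding csr_def Let_def r_def[symmetric] e_def[symmetric] by (rule trop_mult_ge)
  finally show ?thesis .
qed

lemma csr_attained:
  assumes "k mod \<gamma> \<le> (t + 1) * \<gamma>" and "\<And>i j. M $ i $ j \<le> 0"
    and "csr (support_mat G) \<gamma> t k M $ i $ j \<noteq> -\<infinity>"
  shows "\<exists>a b. (a, b) \<in> parcs G ^^ (2 * ((t + 1) * \<gamma>) - k mod \<gamma>)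
      \<and> csr (support_mat G) \<gamma> t k M $ i $ j = M $ i $ a + M $ b $ j"
proof -
  let ?S = "support_mat G"
  define r e where "r = k mod \<gamma>" and "e = (t + 1) * \<gamma> - r"
  have er: "2 * ((t + 1) * \<gamma>) - k mod \<gamma> = e + r + e"
    unfolding e_def r_def by (rule double_diff[OF assms(1)])
  let ?P = "trop_pow ?S e"
  obtain y where y: "csr ?S \<gamma> t k M $ i $ j = (M \<otimes> ?P \<otimes> trop_pow ?S r) $ i $ y + (?P \<otimes> M) $ y $ j"
    unfolding csr_def Let_def r_def[symmetric] e_def[symmetric]
    using trop_mult_attained[of "M \<otimes> ?P \<otimes> trop_pow ?S r" "?P \<otimes> M" i j] by blast
  obtain x where x: "(M \<otimes> ?P \<otimes> trop_pow ?S r) $ i $ y = (M \<otimes> ?P) $ i $ x + trop_pow ?S r $ x $ y"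
    using trop_mult_attained[of "M \<otimes> ?P" "trop_pow ?S r" i y] by blast
  obtain a where a: "(M \<otimes> ?P) $ i $ x = M $ i $ a + ?P $ a $ x"
    using trop_mult_attained[of M ?P i x] by blast
  obtain b where b: "(?P \<otimes> M) $ y $ j = ?P $ y $ b + M $ b $ j"
    using trop_mult_attained[of ?P M y j] by blast
  have M: "M $ i $ a \<le> 0" "M $ b $ j \<le> 0" using assms(2) by auto
  have eq: "csr ?S \<gamma> t k M $ i $ j
      = M $ i $ a + ?P $ a $ x + trop_pow ?S r $ x $ y + (?P $ y $ b + M $ b $ j)"
    unfolding y x a b by (rule refl)
  have "M $ i $ a \<noteq> \<infinity>" "M $ b $ j \<noteq> \<infinity>" using M by auto
  \<comment> \<open>As \<open>M\<close> contributes no \<open>\<infinity>\<close>, a single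
    \<open>-\<infinity>\<close> would make the whole sum \<open>-\<infinity>\<close>; so all three
    conditions hold.\<close>
  moreover have "M $ i $ a + (if (a, x) \<in> parcs G ^^ e then 0 else -\<infinity>)
      + (if (x, y) \<in> parcs G ^^ r then 0 else -\<infinity>)
      + ((if (y, b) \<in> parcs G ^^ e then 0 else -\<infinity>) + M $ b $ j) \<noteq> -\<infinity>"
    using assms(3) unfolding eq trop_pow_support .
  ultimately have R: "(a, x) \<in> parcs G ^^ e" "(x, y) \<in> parcs G ^^ r" "(y, b) \<in> parcs G ^^ e"
    by (simp_all split: if_splits)
  have "(a, b) \<in> parcs G ^^ (e + r + e)"
    using relpow_trans[OF relpow_trans[OF R(1,2)] R(3)] .
  then have "(a, b) \<in> parcs G ^^ (2 * ((t + 1) * \<gamma>) - k mod \<gamma>)" unfolding er .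
  moreover have "csr ?S \<gamma> t k M $ i $ j = M $ i $ a + M $ b $ j"
    unfolding eq using R by (simp add: trop_pow_support)
  ultimately show ?thesis by blast
qed

section \<open>Removing cycles\<close>

text \<open>Every removed arc is charged \<open>\<mu>\<close>, of whatever sign. The induction
  prepends \<open>x\<close> to a path for the tail; if \<open>x\<close> already lies on that path,
  the part up to it closes an elementary cycle, which is dropped. So a bound on elementary cycles is
  enough, and there are only finitely many of those.\<close>

lemma walk_weight_le_path:
  fixes A :: "'n::finite trop_mat" and \<mu> :: real
  assumes cyc: "\<And>z. set z \<subseteq> N \<Longrightarrow> length z \<ge> 2 \<Longrightarrow> hd z = last z \<Longrightarrow> distinct (tl z) \<Longrightarrow>
      walk_weight A z \<le> ereal (\<mu> * (real (length z) - 1))"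
    and p: "p \<noteq> []" "set p \<subseteq> N"
  shows "\<exists>p'. p' \<noteq> [] \<and> distinct p' \<and> set p' \<subseteq> set p \<and> hd p' = hd p \<and> last p' = last p
    \<and> length p' \<le> length p
    \<and> walk_weight A p \<le> walk_weight A p' + ereal (\<mu> * (real (length p) - real (length p')))"
  using p
proof (induction p rule: vwalk_arcs.induct)
  case (2 x) then show ?case by (intro exI[of _ "[x]"]) auto
next
  case (3 x y r)
  define \<delta> where "\<delta> p' = \<mu> * (real (length (y # r)) - real (length p'))" for p' :: "'n list"
  have yr: "y # r \<noteq> []" "set (y # r) \<subseteq> N" using 3(3) by auto
  obtain p2 where p2: "p2 \<noteq> []" "distinct p2" "set p2 \<subseteq> set (y # r)" "hd p2 = hd (y # r)"
      "last p2 = last (y # r)" "length p2 \<le> length (y # r)"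
      "walk_weight A (y # r) \<le> walk_weight A p2 + ereal (\<delta> p2)"
    using 3(1)[OF yr] unfolding \<delta>_def by blast
  then obtain p3 where p3: "p2 = y # p3" by (cases p2) auto
  have "walk_weight A (x # y # r) \<le> A $ x $ y + (walk_weight A p2 + ereal (\<delta> p2))"
    unfolding walk_weight_simps by (rule add_left_mono[OF p2(7)])
  also have "\<dots> = walk_weight A (x # p2) + ereal (\<delta> p2)" by (simp add: p3 add.assoc)
  finally have le: "walk_weight A (x # y # r) \<le> walk_weight A (x # p2) + ereal (\<delta> p2)" .
  show ?case
  proof (cases "x \<in> set p2")
    case False
    have "\<delta> p2 = \<mu> * (real (length (x # y # r)) - real (length (x # p2)))" by (simp add: \<delta>_def)
    with le have "walk_weight A (x # y # r) \<le> walk_weight A (x # p2)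
        + ereal (\<mu> * (real (length (x # y # r)) - real (length (x # p2))))" by (simp only:)
    moreover have "distinct (x # p2)" using False p2(2) by simp
    moreover have "set (x # p2) \<subseteq> set (x # y # r)" using p2(3) by auto
    moreover have "last (x # p2) = last (x # y # r)" using p2(1,5) by simp
    moreover have "length (x # p2) \<le> length (x # y # r)" using p2(6) by simp
    moreover have "x # p2 \<noteq> []" "hd (x # p2) = hd (x # y # r)" by simp_all
    ultimately show ?thesis by blast
  next
    case True
    then obtain u w where uw: "p2 = u @ x # w" by (meson split_list)
    have "walk_weight A (x # p2) = walk_weight A (x # u @ [x]) + walk_weight A (x # w)"
      using walk_weight_append[of A "x # u" x w] by (simp add: uw)
    moreover have "walk_weight A (x # u @ [x]) \<le> ereal (\<mu> * (real (length (x # u @ [x])) - 1))"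
      by (rule cyc) (use p2(2,3) 3(3) uw in auto)
    then have "walk_weight A (x # u @ [x]) \<le> ereal (\<mu> * (real (length u) + 1))"
      by (simp add: add.commute)
    ultimately have "walk_weight A (x # p2) \<le> ereal (\<mu> * (real (length u) + 1)) + walk_weight A (x # w)"
      by (simp only: add_right_mono)
    then have "walk_weight A (x # p2) + ereal (\<delta> p2)
        \<le> ereal (\<mu> * (real (length u) + 1)) + walk_weight A (x # w) + ereal (\<delta> p2)"
      by (rule add_right_mono)
    also have "\<dots> = walk_weight A (x # w) + (ereal (\<mu> * (real (length u) + 1)) + ereal (\<delta> p2))"
      by (simp only: ac_simps)
    also have "ereal (\<mu> * (real (length u) + 1)) + ereal (\<delta> p2)
        = ereal (\<mu> * (real (length (x # y # r)) - real (length (x # w))))"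
      by (simp add: \<delta>_def uw algebra_simps)
    finally have "walk_weight A (x # p2) + ereal (\<delta> p2) \<le> walk_weight A (x # w)
        + ereal (\<mu> * (real (length (x # y # r)) - real (length (x # w))))" .
    with le have "walk_weight A (x # y # r) \<le> walk_weight A (x # w)
        + ereal (\<mu> * (real (length (x # y # r)) - real (length (x # w))))"
      by (rule order_trans)
    moreover have "distinct (x # w)" using p2(2) unfolding uw by simp
    moreover have "set (x # w) \<subseteq> set (x # y # r)" using p2(3) unfolding uw by auto
    moreover have "last (x # w) = last (x # y # r)" using p2(5) unfolding uw by simp
    moreover have "length (x # w) \<le> length (x # y # r)" using p2(6) unfolding uw by simp
    moreover have "x # w \<noteq> []" "hd (x # w) = hd (x # y # r)" by simp_all
    ultimately show ?thesis by blast
  qed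
qed simp

text \<open>Elementary closed walks are finitely many and have at most \<open>CARD('n)\<close> arcs,
  so a negative bound on their weights, divided by that number, is a uniform rate. Cycle removal
  extends it to all closed walks.\<close>

lemma closed_walk_rate:
  fixes A :: "'n::finite trop_mat"
  assumes neg: "\<And>z. set z \<subseteq> N \<Longrightarrow> length z \<ge> 2 \<Longrightarrow> hd z = last z \<Longrightarrow> walk_weight A z < 0"
  shows "\<exists>\<mu><0. \<forall>z. set z \<subseteq> N \<longrightarrow> length z \<ge> 2 \<longrightarrow> hd z = last z \<longrightarrow>
      walk_weight A z \<le> ereal (\<mu> * (real (length z) - 1))"
proof -
  let ?n = "CARD('n)"
  define F where "F = {z. set z \<subseteq> N \<and> length z \<ge> 2 \<and> hd z = last z \<and> distinct (tl z)}"
  have len: "length z - 1 \<le> ?n" if "z \<in> F" for z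
  proof -
    have "length (tl z) = card (set (tl z))" using that by (auto simp: F_def distinct_card)
    also have "\<dots> \<le> ?n" by (rule card_mono) auto
    finally show ?thesis by simp
  qed
  have "F \<subseteq> {z. set z \<subseteq> (UNIV :: 'n set) \<and> length z \<le> Suc ?n}" using len by fastforce
  then have finF: "finite F" by (rule finite_subset[OF _ finite_lists_length_le]) simp
  \<comment> \<open>The value -1 keeps the maximum real when \<open>F\<close> is empty or all its
    weights are \<open>-\<infinity>\<close>.\<close>
  define w where "w = Max (insert (-1) (walk_weight A ` F))"
  have "w < 0" unfolding w_def using finF neg by (subst Max_less_iff) (auto simp: F_def)
  moreover have "-1 \<le> w" unfolding w_def using finF by (intro Max_ge) auto
  ultimately obtain c where c: "w = ereal c" "c < 0" by (cases w) auto
  have n: "real ?n > 0" by (simp add: zero_less_card_finite)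
  define \<mu> where "\<mu> = c / real ?n"
  have \<mu>: "\<mu> < 0" using c n by (simp add: \<mu>_def divide_neg_pos)
  have rate: "walk_weight A z \<le> ereal (\<mu> * (real (length z) - 1))" if z: "z \<in> F" for z
  proof -
    have "walk_weight A z \<le> ereal c" unfolding c(1)[symmetric] w_def using finF z by (intro Max_ge) auto
    moreover have "real (length z) - 1 \<le> real ?n" using len[OF z] by linarith
    then have "\<mu> * real ?n \<le> \<mu> * (real (length z) - 1)" using \<mu> by (simp add: mult_left_mono_neg)
    moreover have "\<mu> * real ?n = c" using n by (simp add: \<mu>_def)
    ultimately show ?thesis by (metis ereal_less_eq(3) order_trans)
  qed
  have "walk_weight A z \<le> ereal (\<mu> * (real (length z) - 1))"
    if z: "set z \<subseteq> N" "length z \<ge> 2" "hd z = last z" for z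
  proof -
    have "\<exists>p'. p' \<noteq> [] \<and> distinct p' \<and> set p' \<subseteq> set z \<and> hd p' = hd z \<and> last p' = last z
      \<and> length p' \<le> length z
      \<and> walk_weight A z \<le> walk_weight A p' + ereal (\<mu> * (real (length z) - real (length p')))"
    proof (rule walk_weight_le_path[where N = N])
      fix y :: "'n list"
      assume "set y \<subseteq> N" "length y \<ge> 2" "hd y = last y" "distinct (tl y)"
      then have "y \<in> F" by (simp add: F_def)
      then show "walk_weight A y \<le> ereal (\<mu> * (real (length y) - 1))" by (rule rate)
    next
      show "z \<noteq> []" using z(2) by auto
    qed (rule z(1))
    then obtain p' where p': "p' \<noteq> []" "distinct p'" "hd p' = hd z" "last p' = last z"
        "walk_weight A z \<le> walk_weight A p' + ereal (\<mu> * (real (length z) - real (length p')))"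
      by blast
    \<comment> \<open>A path with equal endpoints is a single node of weight 0, so only the charge
      for the removed arcs remains.\<close>
    have "hd p' = last p'" using p'(3,4) z(3) by simp
    then obtain x where "p' = [x]"
      using p'(1,2) by (cases p') (auto split: if_splits)
    then show ?thesis using p'(5) by simp
  qed
  with \<mu> show ?thesis by blast
qed

section \<open>Walks that avoid a set of nodes\<close>

lemma walk_weight_remove_nodes:
  "set p \<inter> V = {} \<Longrightarrow> walk_weight (remove_nodes A V) p = walk_weight A p"
  by (induction p rule: vwalk_arcs.induct) (auto simp: remove_nodes_def)

lemma remove_nodes_nonpos: "(\<And>i j. A $ i $ j \<le> 0) \<Longrightarrow> remove_nodes A V $ i $ j \<le> 0"
  by (simp add: remove_nodes_def)

lemma vwalk_arcs_subset_Times: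
  "set (vwalk_arcs p) \<subseteq> W \<times> W \<Longrightarrow> length p \<ge> 2 \<Longrightarrow> set p \<subseteq> W"
proof (induction p rule: vwalk_arcs.induct)
  case (3 x y xs)
  then have "x \<in> W" "y \<in> W" by auto
  moreover have "set (y # xs) \<subseteq> W"
  proof (cases xs)
    case Nil then show ?thesis using \<open>y \<in> W\<close> by simp
  next
    case (Cons z zs)
    have "set (vwalk_arcs (y # xs)) \<subseteq> W \<times> W" using 3(2) by simp
    then show ?thesis using 3(1) Cons by simp
  qed
  ultimately show ?case by simp
qed simp_all

lemma vwalk_arcs_remove_nodes_avoid:
  assumes "set (vwalk_arcs p) \<subseteq> {(i, j). remove_nodes A V $ i $ j \<noteq> -\<infinity>}" "length p \<ge> 2"
  shows "set p \<inter> V = {}"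
proof -
  have "{(i, j). remove_nodes A V $ i $ j \<noteq> -\<infinity>} \<subseteq> (-V) \<times> (-V)"
    by (auto simp: remove_nodes_def split: if_splits)
  with assms(1) have "set (vwalk_arcs p) \<subseteq> (-V) \<times> (-V)" by (rule order_trans)
  then have "set p \<subseteq> -V" using assms(2) by (rule vwalk_arcs_subset_Times)
  then show ?thesis by auto
qed

text \<open>A real upper bound \<open>\<mu>\<close> takes the place of the cycle mean, which may be
  \<open>-\<infinity>\<close>, so that it can be multiplied by a length.\<close>

lemma max_cycle_mean_bound:
  fixes \<mu> :: real
  assumes nonpos: "\<And>i j. A $ i $ j \<le> 0"
    and L: "max_cycle_mean (remove_nodes A V) \<le> ereal \<mu>"
    and z: "set z \<inter> V = {}" "length z \<ge> 2" "hd z = last z"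
  shows "walk_weight A z \<le> ereal (\<mu> * (real (length z) - 1))"
proof (cases "walk_weight A z")
  case (real r)
  let ?B = "remove_nodes A V"
  have w: "walk_weight ?B z = ereal r" using walk_weight_remove_nodes[OF z(1), of A] real by simp
  have "vwalk z (with_proj (digraph_of ?B))"
    using vwalk_digraph_iff[of ?B z, OF remove_nodes_nonpos[OF nonpos]] w z(2) by auto
  then have "vcycle z (digraph_of ?B)" using z by (simp add: vcycle_def)
  then have "mean_weight ?B z \<le> max_cycle_mean ?B"
    unfolding max_cycle_mean_def by (intro Sup_upper) blast
  with L have "mean_weight ?B z \<le> ereal \<mu>" by (rule order_trans[rotated])
  moreover have "real (length z - 1) > 0" "real (length z - 1) = real (length z) - 1" using z(2) by auto
  ultimately have "r / (real (length z) - 1) \<le> \<mu>" "real (length z) - 1 > 0"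
    using w by (auto simp: mean_weight_def)
  then show ?thesis using real by (simp add: pos_divide_le_eq mult.commute)
next
  case PInf
  then show ?thesis using walk_weight_nonpos[of A z] nonpos by simp
next
  case MInf
  then show ?thesis by simp
qed

text \<open>The cycle mean is a supremum over possibly infinitely many closed walks, so negativity
  of each is not enough by itself; \<open>closed_walk_rate\<close> supplies one negative
  \<open>\<mu>\<close> for all of them.\<close>

lemma max_cycle_mean_neg:
  fixes A :: "'n::finite trop_mat"
  assumes neg: "\<And>z. set z \<subseteq> -V \<Longrightarrow> length z \<ge> 2 \<Longrightarrow> hd z = last z \<Longrightarrow> walk_weight A z < 0"
  shows "max_cycle_mean (remove_nodes A V) < 0"
proof -
  let ?B = "remove_nodes A V"
  obtain \<mu> :: real where \<mu>: "\<mu> < 0"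
      "\<And>z. set z \<subseteq> -V \<Longrightarrow> length z \<ge> 2 \<Longrightarrow> hd z = last z \<Longrightarrow>
        walk_weight A z \<le> ereal (\<mu> * (real (length z) - 1))"
    using closed_walk_rate[of "-V" A, OF neg] by blast
  have "mean_weight ?B p \<le> ereal \<mu>" if p: "vcycle p (digraph_of ?B)" for p
  proof -
    have p': "length p \<ge> 2" "hd p = last p" "set (vwalk_arcs p) \<subseteq> {(i, j). ?B $ i $ j \<noteq> -\<infinity>}"
      using p by (auto simp: vcycle_def vwalk_def digraph_of_def)
    have av: "set p \<inter> V = {}" using vwalk_arcs_remove_nodes_avoid[OF p'(3,1)] .
    have "walk_weight ?B p \<le> ereal (\<mu> * (real (length p) - 1))"
      unfolding walk_weight_remove_nodes[OF av] by (rule \<mu>(2)) (use av p' in auto)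
    moreover have "real (length p - 1) > 0" "real (length p - 1) = real (length p) - 1"
      using p'(1) by auto
    ultimately show ?thesis
      by (cases "walk_weight ?B p") (auto simp: mean_weight_def pos_divide_le_eq)
  qed
  then have "max_cycle_mean ?B \<le> ereal \<mu>" unfolding max_cycle_mean_def by (intro Sup_least) blast
  also have "ereal \<mu> < 0" using \<mu>(1) by simp
  finally show ?thesis .
qed

lemma distinct_avoiding_length:
  fixes V :: "'n::finite set"
  assumes "distinct p" "set p \<inter> V = {}"
  shows "length p \<le> CARD('n) - card V"
proof -
  have "length p = card (set p)" using assms(1) by (simp add: distinct_card)
  also have "\<dots> \<le> card (UNIV - V)" by (rule card_mono) (use assms(2) in auto)
  also have "\<dots> = CARD('n) - card V" by (rule card_Diff_subset) auto
  finally show ?thesis .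
qed

lemma card_set_le_CARD: "card (V :: 'n::finite set) \<le> CARD('n)"
  by (rule card_mono) auto

lemma walk_weight_snoc: "p \<noteq> [] \<Longrightarrow> walk_weight A (p @ [c]) = walk_weight A p + A $ last p $ c"
proof (induction p rule: vwalk_arcs.induct)
  case (3 x y xs) then show ?case by (simp add: add.assoc)
qed simp_all

lemma walk_weight_Cons: "p \<noteq> [] \<Longrightarrow> walk_weight A (c # p) = A $ c $ hd p + walk_weight A p"
  by (cases p) simp_all

lemma path_weight_le_max_path_to:
  assumes nonpos: "\<And>i j. A $ i $ j \<le> 0" and path: "distinct (p @ [c])" "c \<in> V"
  shows "walk_weight A (p @ [c]) \<le> max_path_to A V (hd (p @ [c]))"
proof (cases "walk_weight A (p @ [c]) = -\<infinity>")
  case False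
  then have "vpath (p @ [c]) (with_proj (digraph_of A))"
    using vwalk_digraph_iff[of A "p @ [c]", OF nonpos] path(1) by (auto simp: vpath_def)
  then show ?thesis unfolding max_path_to_def using path(2) by (intro Sup_upper) auto
qed simp

lemma path_weight_le_max_path_from:
  assumes nonpos: "\<And>i j. A $ i $ j \<le> 0" and path: "distinct (c # p)" "c \<in> V"
  shows "walk_weight A (c # p) \<le> max_path_from A V (last (c # p))"
proof (cases "walk_weight A (c # p) = -\<infinity>")
  case False
  then have "vpath (c # p) (with_proj (digraph_of A))"
    using vwalk_digraph_iff[of A "c # p", OF nonpos] path(1) by (auto simp: vpath_def)
  then show ?thesis unfolding max_path_from_def using path(2)
    by (intro Sup_upper CollectI exI[of _ "c # p"]) simp
qed simp

locale avoiding_rate =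
  fixes A :: "'n::finite trop_mat" and V :: "'n set" and \<mu> :: real
  assumes nonpos: "A $ i $ j \<le> 0"
    and rate: "set z \<inter> V = {} \<Longrightarrow> length z \<ge> 2 \<Longrightarrow> hd z = last z \<Longrightarrow>
      walk_weight A z \<le> ereal (\<mu> * (real (length z) - 1))"
    and \<mu>_nonpos: "\<mu> \<le> 0"
begin

text \<open>The remaining path has at most n - q nodes, where q = \<open>card V\<close>; as
  \<open>\<mu> \<le> 0\<close>, the estimate is weakest when it has exactly that many.\<close>

lemma avoiding_path:
  assumes "p \<noteq> []" "set p \<inter> V = {}"
  obtains p' where "p' \<noteq> []" "distinct p'" "set p' \<inter> V = {}" "hd p' = hd p" "last p' = last p"
    "walk_weight A p \<le> walk_weight A p'
      + ereal (\<mu> * (real (length p) - (real CARD('n) - real (card V))))"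
proof -
  have "\<exists>p'. p' \<noteq> [] \<and> distinct p' \<and> set p' \<subseteq> set p \<and> hd p' = hd p \<and> last p' = last p
    \<and> length p' \<le> length p
    \<and> walk_weight A p \<le> walk_weight A p' + ereal (\<mu> * (real (length p) - real (length p')))"
  proof (rule walk_weight_le_path[where N = "-V"])
    fix z assume "set z \<subseteq> -V" "length z \<ge> 2" "hd z = last z"
    then show "walk_weight A z \<le> ereal (\<mu> * (real (length z) - 1))" by (intro rate) auto
  qed (use assms in auto)
  then obtain p' where p': "p' \<noteq> []" "distinct p'" "set p' \<subseteq> set p" "hd p' = hd p" "last p' = last p"
    "walk_weight A p \<le> walk_weight A p' + ereal (\<mu> * (real (length p) - real (length p')))"
    by blast
  have av: "set p' \<inter> V = {}" using p'(3) assms(2) by auto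
  have "length p' \<le> CARD('n) - card V" by (rule distinct_avoiding_length[OF p'(2) av])
  then have "real (length p') \<le> real CARD('n) - real (card V)"
    using card_set_le_CARD[of V] by linarith
  then have "\<mu> * (real (length p) - real (length p'))
      \<le> \<mu> * (real (length p) - (real CARD('n) - real (card V)))"
    using \<mu>_nonpos by (intro mult_left_mono_neg) auto
  then have "walk_weight A p' + ereal (\<mu> * (real (length p) - real (length p')))
      \<le> walk_weight A p' + ereal (\<mu> * (real (length p) - (real CARD('n) - real (card V))))"
    by (intro add_left_mono) simp
  with p'(6) have "walk_weight A p
      \<le> walk_weight A p' + ereal (\<mu> * (real (length p) - (real CARD('n) - real (card V))))"
    by (rule order_trans)
  from that[OF p'(1,2) av p'(4,5) this] show thesis .
qed

text \<open>The critical endpoint is split off before cycles are removed, so the reduced path avoids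
  \<open>V\<close> and remains a path when \<open>c\<close> is appended. Thus
  \<open>length p\<close> counts both the nodes outside \<open>V\<close> and the arcs of the whole
  walk.\<close>

lemma walk_to_bound:
  assumes p: "set p \<inter> V = {}" and c: "c \<in> V"
  shows "walk_weight A (p @ [c]) \<le> max_path_to A V (hd (p @ [c]))
    + ereal (\<mu> * (real (length p) - (real CARD('n) - real (card V))))"
    (is "_ \<le> _ + ereal ?\<delta>")
proof (cases "p = []")
  case True
  \<comment> \<open>With no node outside \<open>V\<close> the length term is at most 0, so the
    allowance is nonnegative and may be added for free.\<close>
  have "0 \<le> ?\<delta>" using card_set_le_CARD[of V] True \<mu>_nonpos by (simp add: mult_nonpos_nonpos)
  moreover have "walk_weight A (p @ [c]) \<le> max_path_to A V (hd (p @ [c]))"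
    by (rule path_weight_le_max_path_to[OF nonpos]) (use True c in auto)
  ultimately have "walk_weight A (p @ [c]) + 0 \<le> max_path_to A V (hd (p @ [c])) + ereal ?\<delta>"
    by (intro add_mono) auto
  then show ?thesis by simp
next
  case False
  then obtain p' where p': "p' \<noteq> []" "distinct p'" "set p' \<inter> V = {}" "hd p' = hd p" "last p' = last p"
      "walk_weight A p \<le> walk_weight A p' + ereal ?\<delta>"
    using avoiding_path[OF False p] by blast
  have "walk_weight A (p @ [c]) \<le> walk_weight A p' + ereal ?\<delta> + A $ last p $ c"
    unfolding walk_weight_snoc[OF False] by (rule add_right_mono[OF p'(6)])
  also have "\<dots> = walk_weight A (p' @ [c]) + ereal ?\<delta>"
    using p'(1,5) by (simp add: walk_weight_snoc ac_simps)
  also have "\<dots> \<le> max_path_to A V (hd (p' @ [c])) + ereal ?\<delta>"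
    by (intro add_right_mono path_weight_le_max_path_to[OF nonpos]) (use p'(2,3) c in auto)
  finally show ?thesis using p'(1,4) False by simp
qed

lemma walk_from_bound:
  assumes p: "set p \<inter> V = {}" and c: "c \<in> V"
  shows "walk_weight A (c # p) \<le> max_path_from A V (last (c # p))
    + ereal (\<mu> * (real (length p) - (real CARD('n) - real (card V))))"
    (is "_ \<le> _ + ereal ?\<delta>")
proof (cases "p = []")
  case True
  have "0 \<le> ?\<delta>" using card_set_le_CARD[of V] True \<mu>_nonpos by (simp add: mult_nonpos_nonpos)
  moreover have "walk_weight A (c # p) \<le> max_path_from A V (last (c # p))"
    by (rule path_weight_le_max_path_from[OF nonpos]) (use True c in auto)
  ultimately have "walk_weight A (c # p) + 0 \<le> max_path_from A V (last (c # p)) + ereal ?\<delta>"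
    by (intro add_mono) auto
  then show ?thesis by simp
next
  case False
  then obtain p' where p': "p' \<noteq> []" "distinct p'" "set p' \<inter> V = {}" "hd p' = hd p" "last p' = last p"
      "walk_weight A p \<le> walk_weight A p' + ereal ?\<delta>"
    using avoiding_path[OF False p] by blast
  have "walk_weight A (c # p) \<le> A $ c $ hd p + (walk_weight A p' + ereal ?\<delta>)"
    unfolding walk_weight_Cons[OF False] by (rule add_left_mono[OF p'(6)])
  also have "\<dots> = walk_weight A (c # p') + ereal ?\<delta>"
    using p'(1,4) by (simp add: walk_weight_Cons ac_simps)
  also have "\<dots> \<le> max_path_from A V (last (c # p')) + ereal ?\<delta>"
    by (intro add_right_mono path_weight_le_max_path_from[OF nonpos]) (use p'(2,3) c in auto)
  finally show ?thesis using p'(1,5) False by simp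
qed

text \<open>\<open>max_path_avoiding\<close> switches to cycles when the endpoints agree, so the
  walk must not shrink to a single node: its last node is split off, the rest is reduced to a path,
  and the node is put back. This leaves up to n - q arcs, one more than a path can have, hence the
  \<open>- 1\<close> in the allowance. For distinct endpoints the estimate is weakened to the same
  form.\<close>

lemma walk_avoiding_bound:
  assumes p: "set p \<inter> V = {}" and len: "length p \<ge> 2"
  shows "walk_weight A p \<le> max_path_avoiding A V (hd p) (last p)
    + ereal (\<mu> * (real (length p) - 1 - (real CARD('n) - real (card V))))"
    (is "_ \<le> _ + ereal ?\<delta>")
proof -
  let ?N = "real CARD('n) - real (card V)"
  have ne: "p \<noteq> []" using len by auto
  obtain q where q: "walk_weight A p \<le> walk_weight A q + ereal ?\<delta>"
      "walk_weight A q \<le> max_path_avoiding A V (hd p) (last p)"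
  proof (cases "hd p = last p")
    case False
    obtain p' where p': "p' \<noteq> []" "distinct p'" "set p' \<inter> V = {}" "hd p' = hd p" "last p' = last p"
        "walk_weight A p \<le> walk_weight A p' + ereal (\<mu> * (real (length p) - ?N))"
      using avoiding_path[OF ne p] by blast
    have "\<mu> * (real (length p) - ?N) \<le> ?\<delta>"
      using \<mu>_nonpos by (intro mult_left_mono_neg) auto
    then have "walk_weight A p' + ereal (\<mu> * (real (length p) - ?N)) \<le> walk_weight A p' + ereal ?\<delta>"
      by (intro add_left_mono) simp
    with p'(6) have 1: "walk_weight A p \<le> walk_weight A p' + ereal ?\<delta>" by (rule order_trans)
    have 2: "walk_weight A p' \<le> max_path_avoiding A V (hd p) (last p)"
    proof (cases "walk_weight A p' = -\<infinity>")
      case nz: False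
      then have "vpath p' (with_proj (digraph_of A))"
        using vwalk_digraph_iff[of A p', OF nonpos] p'(1,2) by (auto simp: vpath_def)
      then show ?thesis unfolding max_path_avoiding_def if_not_P[OF False] using p'(3-5)
        by (intro Sup_upper CollectI exI[of _ p']) simp
    qed simp
    from that[OF 1 2] show thesis .
  next
    case True
    define r where "r = butlast p"
    have pr: "p = r @ [last p]" using ne by (simp add: r_def)
    have r: "r \<noteq> []" "set r \<inter> V = {}" "hd r = last p" "real (length r) = real (length p) - 1"
    proof -
      have "length r > 0" using len by (simp add: r_def)
      then show "r \<noteq> []" by simp
      then show "hd r = last p" using True pr by (metis hd_append2)
      show "set r \<inter> V = {}" using p in_set_butlastD[of _ p] by (auto simp: r_def)
      show "real (length r) = real (length p) - 1" using len by (simp add: r_def)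
    qed
    obtain r' where r': "r' \<noteq> []" "distinct r'" "set r' \<inter> V = {}" "hd r' = hd r" "last r' = last r"
        "walk_weight A r \<le> walk_weight A r' + ereal (\<mu> * (real (length r) - ?N))"
      using avoiding_path[OF r(1,2)] by blast
    have "walk_weight A p = walk_weight A r + A $ last r $ last p"
      using walk_weight_snoc[OF r(1), of A "last p"] pr by simp
    also have "\<dots> \<le> walk_weight A r' + ereal (\<mu> * (real (length r) - ?N)) + A $ last r $ last p"
      by (rule add_right_mono[OF r'(6)])
    also have "\<dots> = walk_weight A (r' @ [last p]) + ereal ?\<delta>"
      using r'(1,5) r(4) by (simp add: walk_weight_snoc ac_simps)
    finally have 1: "walk_weight A p \<le> walk_weight A (r' @ [last p]) + ereal ?\<delta>" .
    have 2: "walk_weight A (r' @ [last p]) \<le> max_path_avoiding A V (hd p) (last p)"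
    proof (cases "walk_weight A (r' @ [last p]) = -\<infinity>")
      case False
      then have "vwalk (r' @ [last p]) (with_proj (digraph_of A))"
        using vwalk_digraph_iff[of A "r' @ [last p]", OF nonpos] by simp
      then have "vcycle (r' @ [last p]) (digraph_of A)"
        using r'(1,4) r(3) by (cases r') (auto simp: vcycle_def)
      moreover have "set (r' @ [last p]) \<inter> V = {}" using r'(3) p last_in_set[OF ne] by auto
      ultimately show ?thesis unfolding True max_path_avoiding_def if_P[OF refl]
        by (intro Sup_upper CollectI exI[of _ "r' @ [last p]"]) simp
    qed simp
    from that[OF 1 2] show thesis .
  qed
  from q(2) have "walk_weight A q + ereal ?\<delta> \<le> max_path_avoiding A V (hd p) (last p) + ereal ?\<delta>"
    by (rule add_right_mono)
  with q(1) show ?thesis by (rule order_trans)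
qed

end

section \<open>Digraphs as relations, and optimal paths that are attained\<close>

lemma relpow_subset: "R \<subseteq> S \<Longrightarrow> (a, b) \<in> R ^^ n \<Longrightarrow> (a, b) \<in> S ^^ n"
  for R S :: "('a \<times> 'a) set"
proof (induction n arbitrary: b)
  case (Suc n) then show ?case by (auto elim!: relpow_Suc_E)
qed simp

lemma in_set_vwalk_arcs: "(x, y) \<in> set (vwalk_arcs p) \<Longrightarrow> x \<in> set p \<and> y \<in> set p"
  by (induction p rule: vwalk_arcs.induct) auto

lemma cyclic_relation_digraph:
  assumes sub: "parcs G \<subseteq> pverts G \<times> pverts G" and fin: "finite (pverts G)"
    and sc: "strongly_connected (with_proj G)" and ne: "parcs G \<noteq> {}"
  shows "cyclic_relation (pverts G) (parcs G) (cyclicity G)"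
proof
  show "(a, b) \<in> (parcs G)\<^sup>*" if "a \<in> pverts G" "b \<in> pverts G" for a b
  proof -
    have "(a, b) \<in> rtrancl_on (verts (with_proj G)) (arcs_ends (with_proj G))"
      using sc that unfolding strongly_connected_def reachable_def by simp
    then have "(a, b) \<in> (arcs_ends (with_proj G))\<^sup>*" by (rule rtrancl_on_rtranclI)
    then show ?thesis by simp
  qed
  have "{vwalk_length p |p. vcycle p G} = {l. l > 0 \<and> (\<exists>a\<in>pverts G. (a, a) \<in> parcs G ^^ l)}"
    (is "?L = ?R")
  proof
    show "?L \<subseteq> ?R"
    proof
      fix l assume "l \<in> ?L"
      then obtain p where p: "vcycle p G" "l = length p - 1" by auto
      then have vw: "set p \<subseteq> pverts G" "set (vwalk_arcs p) \<subseteq> parcs G" "p \<noteq> []" "hd p = last p" "l > 0"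
        by (auto simp: vcycle_def vwalk_def)
      have "(hd p, last p) \<in> parcs G ^^ l" using vwalk_relpow[OF vw(2,3)] p(2) by simp
      then show "l \<in> ?R" using vw by (auto intro!: bexI[of _ "last p"])
    qed
    show "?R \<subseteq> ?L"
    proof
      fix l assume "l \<in> ?R"
      then obtain a where a: "l > 0" "(a, a) \<in> parcs G ^^ l" by auto
      obtain p where p: "length p = Suc l" "hd p = a" "last p = a" "set (vwalk_arcs p) \<subseteq> parcs G"
        using relpow_vwalk[OF a(2)] by blast
      have "set p \<subseteq> pverts G"
        by (rule vwalk_arcs_subset_Times) (use p a(1) sub in auto)
      then have "vcycle p G" using p a(1) by (auto simp: vcycle_def vwalk_def)
      moreover have "l = vwalk_length p" using p(1) by simp
      ultimately show "l \<in> ?L" by blast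
    qed
  qed
  then show "cyclicity G = Gcd {l. l > 0 \<and> (\<exists>a\<in>pverts G. (a, a) \<in> parcs G ^^ l)}"
    unfolding cyclicity_def by (rule arg_cong)
qed (use sub fin ne in auto)

text \<open>Cycle removal at rate 0: dropping cycles of nonpositive weight does not lower the
  weight, so a weight above \<open>-\<infinity>\<close> stays above it.\<close>

lemma walk_imp_path:
  fixes A :: "'n::finite trop_mat"
  assumes nonpos: "\<And>i j. A $ i $ j \<le> 0"
    and w: "(i, j) \<in> {(i, j). A $ i $ j \<noteq> -\<infinity>}\<^sup>*"
  shows "\<exists>p. vpath p (with_proj (digraph_of A)) \<and> hd p = i \<and> last p = j"
proof -
  obtain m where "(i, j) \<in> {(i, j). A $ i $ j \<noteq> -\<infinity>} ^^ m" using rtrancl_imp_relpow[OF w] by blast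
  from relpow_vwalk[OF this] obtain p where p: "length p = Suc m" "hd p = i" "last p = j"
      "set (vwalk_arcs p) \<subseteq> {(i, j). A $ i $ j \<noteq> -\<infinity>}" by blast
  have wp: "walk_weight A p \<noteq> -\<infinity>" using vwalk_arcs_of_weight[of A p] nonpos p(4) by simp
  have "\<exists>p'. p' \<noteq> [] \<and> distinct p' \<and> set p' \<subseteq> set p \<and> hd p' = hd p \<and> last p' = last p
    \<and> length p' \<le> length p
    \<and> walk_weight A p \<le> walk_weight A p' + ereal (0 * (real (length p) - real (length p')))"
  proof (rule walk_weight_le_path[where N = UNIV])
    show "walk_weight A z \<le> ereal (0 * (real (length z) - 1))" for z
      using walk_weight_nonpos[of A z] nonpos by (simp add: zero_ereal_def)
    show "p \<noteq> []" using p(1) by auto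
  qed simp
  then obtain p' where p': "p' \<noteq> []" "distinct p'" "hd p' = i" "last p' = j"
      "walk_weight A p \<le> walk_weight A p' + ereal (0 * (real (length p) - real (length p')))"
    using p(2,3) by blast
  have "walk_weight A p' \<noteq> -\<infinity>" using p'(5) wp by auto
  then have "vpath p' (with_proj (digraph_of A))"
    using vwalk_digraph_iff[of A p'] nonpos p'(1,2) by (simp add: vpath_def)
  with p'(3,4) show ?thesis by blast
qed

lemma finite_vpaths: "finite {p :: 'n::finite list. vpath p G \<and> Q p}"
  by (rule finite_subset[OF _ finite_subset_distinct[OF finite_class.finite_UNIV]]) (auto simp: vpath_def)

text \<open>Only finitely many paths compete, so the supremum is attained. As entries are
  nonpositive, an optimal path may be cut at its first critical node; it then meets \<open>V\<close>
  only at its end, which later bounds its number of arcs by n - q.\<close>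

lemma max_path_to_attained:
  fixes A :: "'n::finite trop_mat"
  assumes nonpos: "\<And>i j. A $ i $ j \<le> 0"
    and c: "c0 \<in> V" "(i, c0) \<in> {(i, j). A $ i $ j \<noteq> -\<infinity>}\<^sup>*"
  obtains p c where "set p \<inter> V = {}" "c \<in> V" "hd (p @ [c]) = i" "distinct (p @ [c])"
    "max_path_to A V i = walk_weight A (p @ [c])" "walk_weight A (p @ [c]) \<noteq> -\<infinity>"
proof -
  define P where "P = {p. vpath p (with_proj (digraph_of A)) \<and> hd p = i \<and> last p \<in> V}"
  have finP: "finite P" unfolding P_def by (rule finite_vpaths)
  have neP: "P \<noteq> {}" using walk_imp_path[OF nonpos c(2)] c(1) by (auto simp: P_def)
  have sup: "max_path_to A V i = Sup (walk_weight A ` P)"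
    unfolding max_path_to_def P_def by (rule arg_cong[where f = Sup]) auto
  have "Sup (walk_weight A ` P) = Max (walk_weight A ` P)"
    by (rule cSup_eq_Max) (use finP neP in auto)
  also have "\<dots> \<in> walk_weight A ` P" by (rule Max_in) (use finP neP in auto)
  finally obtain p where p: "p \<in> P" "Sup (walk_weight A ` P) = walk_weight A p" by auto
  have pp: "p \<noteq> []" "distinct p" "hd p = i" "last p \<in> V" "walk_weight A p \<noteq> -\<infinity>"
    using p(1) vwalk_digraph_iff[of A p, OF nonpos] by (auto simp: P_def vpath_def)
  then have "\<exists>x\<in>set p. x \<in> V" using last_in_set by blast
  from split_list_first_prop[OF this] obtain p1 c p2 where
    s: "p = p1 @ c # p2" "c \<in> V" "\<forall>y\<in>set p1. y \<notin> V" by blast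
  have w: "walk_weight A p = walk_weight A (p1 @ [c]) + walk_weight A (c # p2)"
    unfolding s(1) by (rule walk_weight_append)
  have "walk_weight A p \<le> walk_weight A (p1 @ [c]) + 0"
    unfolding w by (rule add_left_mono) (rule walk_weight_nonpos[OF nonpos])
  then have le: "walk_weight A p \<le> walk_weight A (p1 @ [c])" by simp
  then have nz: "walk_weight A (p1 @ [c]) \<noteq> -\<infinity>" using pp(5) by auto
  have hd1: "hd (p1 @ [c]) = i" using pp(3) s(1) by (cases p1) auto
  have d1: "distinct (p1 @ [c])" using pp(2) s(1) by auto
  have "p1 @ [c] \<in> P"
    using vwalk_digraph_iff[of A "p1 @ [c]", OF nonpos] nz hd1 d1 s(2) by (simp add: P_def vpath_def)
  then have "walk_weight A (p1 @ [c]) \<le> Sup (walk_weight A ` P)" by (intro Sup_upper) auto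
  then have eq: "max_path_to A V i = walk_weight A (p1 @ [c])" using le sup p(2) by simp
  have av: "set p1 \<inter> V = {}" using s(3) by auto
  from that[OF av s(2) hd1 d1 eq nz] show thesis .
qed

lemma max_path_from_attained:
  fixes A :: "'n::finite trop_mat"
  assumes nonpos: "\<And>i j. A $ i $ j \<le> 0"
    and c: "c0 \<in> V" "(c0, j) \<in> {(i, j). A $ i $ j \<noteq> -\<infinity>}\<^sup>*"
  obtains p c where "set p \<inter> V = {}" "c \<in> V" "last (c # p) = j" "distinct (c # p)"
    "max_path_from A V j = walk_weight A (c # p)" "walk_weight A (c # p) \<noteq> -\<infinity>"
proof -
  define P where "P = {p. vpath p (with_proj (digraph_of A)) \<and> hd p \<in> V \<and> last p = j}"
  have finP: "finite P" unfolding P_def by (rule finite_vpaths)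
  have neP: "P \<noteq> {}" using walk_imp_path[OF nonpos c(2)] c(1) by (auto simp: P_def)
  have sup: "max_path_from A V j = Sup (walk_weight A ` P)"
    unfolding max_path_from_def P_def by (rule arg_cong[where f = Sup]) auto
  have "Sup (walk_weight A ` P) = Max (walk_weight A ` P)"
    by (rule cSup_eq_Max) (use finP neP in auto)
  also have "\<dots> \<in> walk_weight A ` P" by (rule Max_in) (use finP neP in auto)
  finally obtain p where p: "p \<in> P" "Sup (walk_weight A ` P) = walk_weight A p" by auto
  have pp: "p \<noteq> []" "distinct p" "last p = j" "hd p \<in> V" "walk_weight A p \<noteq> -\<infinity>"
    using p(1) vwalk_digraph_iff[of A p, OF nonpos] by (auto simp: P_def vpath_def)
  then have "\<exists>x\<in>set p. x \<in> V" using hd_in_set by blast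
  from split_list_last_prop[OF this] obtain p1 c p2 where
    s: "p = p1 @ c # p2" "c \<in> V" "\<forall>y\<in>set p2. y \<notin> V" by blast
  have w: "walk_weight A p = walk_weight A (c # p2) + walk_weight A (p1 @ [c])"
    unfolding s(1) by (subst walk_weight_append) (rule add.commute)
  have "walk_weight A p \<le> walk_weight A (c # p2) + 0"
    unfolding w by (rule add_left_mono) (rule walk_weight_nonpos[OF nonpos])
  then have le: "walk_weight A p \<le> walk_weight A (c # p2)" by simp
  then have nz: "walk_weight A (c # p2) \<noteq> -\<infinity>" using pp(5) by auto
  have last2: "last (c # p2) = j" using pp(3) s(1) by simp
  have d2: "distinct (c # p2)" using pp(2) s(1) by simp
  have "c # p2 \<in> P"
    using vwalk_digraph_iff[of A "c # p2", OF nonpos] nz last2 d2 s(2)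
    unfolding P_def vpath_def by simp
  then have "walk_weight A (c # p2) \<le> Sup (walk_weight A ` P)" by (intro Sup_upper) auto
  then have eq: "max_path_from A V j = walk_weight A (c # p2)" using le sup p(2) by simp
  have av: "set p2 \<inter> V = {}" using s(3) by auto
  from that[OF av s(2) last2 d2 eq nz] show thesis .
qed

section \<open>From the bound on k to a real rate\<close>

lemma Sch_pos: "n > 0 \<Longrightarrow> Sch \<gamma> n > 0"
  by (cases "\<gamma> = 0 \<or> n < \<gamma>") (auto simp: Sch_def Wi_def div_eq_0_iff)

text \<open>For finite \<open>L\<close> the rate is \<open>L\<close> itself. For
  \<open>L = -\<infinity>\<close> the quotients vanish and \<open>b1\<close> says
  \<open>c1 \<le> k\<close>; then \<open>k - c1 + 1\<close> and \<open>k - c2\<close> are at least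
  1, and any sufficiently negative \<open>\<mu>\<close> will do. If \<open>g\<close> is
  \<open>-\<infinity>\<close>, there is no condition on avoiding walks.\<close>

lemma rate_choice:
  fixes L g :: ereal and U a c1 c2 k :: real
  assumes L: "L < 0" and Ua: "U \<le> a"
    and b1: "(ereal U - ereal a) / L + ereal c1 \<le> ereal k"
    and b2: "\<And>G. g = ereal G \<Longrightarrow> (ereal U - ereal G) / L + ereal (c2 + 1) \<le> ereal k"
    and c: "c2 + 1 \<le> c1"
  shows "c1 \<le> k" "\<exists>\<mu><0. L \<le> ereal \<mu> \<and> \<mu> * (k - c1 + 1) \<le> U - a
      \<and> (\<forall>G. g = ereal G \<longrightarrow> \<mu> * (k - c2) \<le> U - G)"
proof -
  have "c1 \<le> k \<and> (\<exists>\<mu><0. L \<le> ereal \<mu> \<and> \<mu> * (k - c1 + 1) \<le> U - a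
      \<and> (\<forall>G. g = ereal G \<longrightarrow> \<mu> * (k - c2) \<le> U - G))"
  proof (cases L)
    case (real l)
    then have l: "l < 0" using L by simp
    have "(U - a) / l \<le> k - c1" using b1 real l by simp
    then have m1: "l * (k - c1) \<le> U - a" using l by (simp add: neg_divide_le_eq mult.commute)
    have "0 \<le> (U - a) / l" using Ua l by (simp add: divide_nonpos_neg)
    with \<open>(U - a) / l \<le> k - c1\<close> have ck: "c1 \<le> k" by simp
    have "l * (k - c2) \<le> U - G" if "g = ereal G" for G
    proof -
      have "(U - G) / l \<le> k - c2 - 1" using b2[OF that] real l by simp
      then have "l * (k - c2 - 1) \<le> U - G" using l by (simp add: neg_divide_le_eq mult.commute)
      then show ?thesis using l by (simp add: algebra_simps)
    qed
    moreover have "l * (k - c1 + 1) \<le> U - a" using m1 l by (simp add: algebra_simps)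
    ultimately show ?thesis using real l ck by (intro conjI exI[of _ l]) auto
  next
    case MInf
    have ck: "c1 \<le> k" using b1 unfolding MInf ereal_divide_MInfty by simp
    define \<mu> where "\<mu> = - (\<bar>U - a\<bar> + \<bar>U - real_of_ereal g\<bar> + 1)"
    have le: "\<mu> * x \<le> \<mu>" if "x \<ge> 1" for x
      using that mult_left_mono_neg[of 1 x \<mu>] by (simp add: \<mu>_def)
    have "\<mu> * (k - c1 + 1) \<le> U - a" using le[of "k - c1 + 1"] ck by (simp add: \<mu>_def)
    moreover have "\<mu> * (k - c2) \<le> U - G" if "g = ereal G" for G
      using le[of "k - c2"] ck c that by (simp add: \<mu>_def)
    ultimately show ?thesis using ck MInf by (intro conjI exI[of _ \<mu>]) (auto simp: \<mu>_def)
  qed (use L in simp)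
  then show "c1 \<le> k" "\<exists>\<mu><0. L \<le> ereal \<mu> \<and> \<mu> * (k - c1 + 1) \<le> U - a
      \<and> (\<forall>G. g = ereal G \<longrightarrow> \<mu> * (k - c2) \<le> U - G)" by blast+
qed

section \<open>Products of normalized matrices\<close>

locale csr_setting = common_digraphs X Y D C
  for X Y :: "'n::finite trop_mat set" and D C :: "'n pair_pre_digraph" +
  fixes \<gamma> :: nat
  assumes C_connected: "strongly_connected (with_proj C)"
    and \<gamma>_C: "\<gamma> = cyclicity C"
    and \<gamma>_D: "\<gamma> = cyclicity D"
begin

abbreviation "V \<equiv> pverts C"
abbreviation "Asup \<equiv> sup_mat Y"
abbreviation "Ainf \<equiv> inf_mat Y"

lemma Y_nonempty: "Y \<noteq> {}"
  using X_nonempty by (simp add: Y_eq)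

lemma Y_nonpos: "A \<in> Y \<Longrightarrow> A $ i $ j \<le> 0"
  using Y_critical_zero[of A i j] Y_noncritical_le[of A i j] by (cases "(i, j) \<in> parcs C") auto

lemma sup_nonpos: "Asup $ i $ j \<le> 0"
  using sup_critical_zero[of i j] sup_noncritical_le[of i j] by (cases "(i, j) \<in> parcs C") auto

lemma Y_le_sup: "A \<in> Y \<Longrightarrow> A $ i $ j \<le> Asup $ i $ j"
  by (auto simp: sup_mat_def intro: SUP_upper)

lemma inf_le_Y: "A \<in> Y \<Longrightarrow> Ainf $ i $ j \<le> A $ i $ j"
  by (auto simp: inf_mat_def intro: INF_lower)

lemma inf_le_sup: "Ainf $ i $ j \<le> Asup $ i $ j"
  using Y_nonempty inf_le_Y Y_le_sup by (meson ex_in_conv order_trans)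

lemma inf_nonpos: "Ainf $ i $ j \<le> 0"
  using inf_le_sup sup_nonpos order_trans by blast

lemma parcs_D: "parcs D = {(i, j). Asup $ i $ j \<noteq> -\<infinity>}"
  unfolding sup_digraph[symmetric] by (simp add: digraph_of_def)

lemma pverts_D: "pverts D = UNIV"
  unfolding sup_digraph[symmetric] by (simp add: digraph_of_def)

text \<open>Guarantees paths of weight above \<open>-\<infinity>\<close> on the infimum between any
  two nodes, so that \<open>u\<close> is real.\<close>

lemma parcs_D_inf: "parcs D = {(i, j). Ainf $ i $ j \<noteq> -\<infinity>}"
proof -
  have "Ainf $ i $ j = -\<infinity>" if "Asup $ i $ j = -\<infinity>" for i j
    using inf_le_sup[of i j] that by simp
  then show ?thesis using inf_entries unfolding parcs_D by auto
qed

lemma critical_cycle_in_C: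
  assumes "critical_cycle Asup p"
  shows "set p \<subseteq> V" "set (vwalk_arcs p) \<subseteq> parcs C"
  using assms unfolding sup_critical[symmetric] by (auto simp: critical_digraph_def)

lemma parcs_C_sub: "parcs C \<subseteq> V \<times> V"
  unfolding sup_critical[symmetric] by (auto simp: critical_digraph_def dest: in_set_vwalk_arcs)

lemma parcs_C_sub_D: "parcs C \<subseteq> parcs D"
proof -
  have "set (vwalk_arcs p) \<subseteq> parcs D" if "critical_cycle Asup p" for p
    using that unfolding critical_cycle_def vcycle_def vwalk_def sup_digraph by simp
  then show ?thesis unfolding sup_critical[symmetric] critical_digraph_def by auto
qed

lemma V_nonempty: "V \<noteq> {}"
  using C_connected by (simp add: strongly_connected_def)

lemma critical_cycle_ex: "\<exists>p. critical_cycle Asup p"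
  using V_nonempty unfolding sup_critical[symmetric] by (auto simp: critical_digraph_def)

lemma max_cycle_mean_sup: "max_cycle_mean Asup = 0"
proof -
  obtain p where p: "critical_cycle Asup p" using critical_cycle_ex by blast
  have zero: "set (vwalk_arcs q) \<subseteq> parcs C \<Longrightarrow> walk_weight Asup q = 0" for q
    by (induction q rule: vwalk_arcs.induct) (auto simp: sup_critical_zero)
  have "mean_weight Asup p = 0"
    unfolding mean_weight_def zero[OF critical_cycle_in_C(2)[OF p]] by simp
  then show ?thesis using p by (simp add: critical_cycle_def)
qed

lemma parcs_C_nonempty: "parcs C \<noteq> {}"
proof -
  obtain p where p: "critical_cycle Asup p" using critical_cycle_ex by blast
  then have "length (vwalk_arcs p) \<ge> 1"
    by (simp add: critical_cycle_def vcycle_def flip: vwalk_length_def)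
  then have "set (vwalk_arcs p) \<noteq> {}" by auto
  with critical_cycle_in_C(2)[OF p] show ?thesis by auto
qed

lemma D_connected: "strongly_connected (with_proj D)"
proof -
  obtain A where "A \<in> X" using X_nonempty by blast
  then show ?thesis using X_irreducible[of A] X_digraph[of A] by (simp add: irreducible_mat_def)
qed

sublocale C: cyclic_relation V "parcs C" \<gamma>
  unfolding \<gamma>_C
  by (rule cyclic_relation_digraph[OF parcs_C_sub _ C_connected parcs_C_nonempty]) simp

sublocale D: cyclic_relation UNIV "parcs D" \<gamma>
  unfolding \<gamma>_D pverts_D[symmetric]
  by (rule cyclic_relation_digraph[OF _ _ D_connected])
    (use parcs_C_nonempty parcs_C_sub_D in \<open>auto simp: pverts_D\<close>)

lemma relpow_C_in_V:
  assumes "(a, b) \<in> parcs C ^^ m" "m > 0"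
  shows "a \<in> V" "b \<in> V"
proof -
  have "(a, b) \<in> parcs C ^^ Suc (m - 1)" using assms by simp
  then obtain c where "(a, c) \<in> parcs C" by (rule relpow_Suc_E2)
  then show a: "a \<in> V" using parcs_C_sub by blast
  show "b \<in> V" using C.relpow_in[OF a assms(1)] .
qed

text \<open>A closed walk outside \<open>V\<close> of weight 0 would have mean 0, the maximum; it
  would be critical and its nodes would lie in \<open>V\<close>.\<close>

lemma max_cycle_mean_avoiding: "max_cycle_mean (remove_nodes Asup V) < 0"
proof (rule max_cycle_mean_neg)
  fix z :: "'n list"
  assume z: "set z \<subseteq> -V" "length z \<ge> 2" "hd z = last z"
  show "walk_weight Asup z < 0"
  proof (rule ccontr)
    assume "\<not> walk_weight Asup z < 0"
    then have w: "walk_weight Asup z = 0" using walk_weight_nonpos[of Asup z] sup_nonpos by simp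
    then have "vwalk z (with_proj (digraph_of Asup))"
      using vwalk_digraph_iff[of Asup z, OF sup_nonpos] z(2) by auto
    then have "critical_cycle Asup z"
      using z w by (simp add: critical_cycle_def vcycle_def mean_weight_def max_cycle_mean_sup)
    then have "set z \<subseteq> V" by (rule critical_cycle_in_C)
    moreover have "z \<noteq> []" using z(2) by auto
    ultimately show False using z(1) by (cases z) auto
  qed
qed

lemma avoiding_rateI:
  assumes "max_cycle_mean (remove_nodes Asup V) \<le> ereal \<mu>" "\<mu> \<le> 0"
  shows "avoiding_rate Asup V \<mu>"
  by unfold_locales (use max_cycle_mean_bound[OF sup_nonpos assms(1)] assms(2) sup_nonpos in auto)

section \<open>Walks in a product and critical stretches inside it\<close>

lemma walk_weight_relpow_D:
  assumes "walk_weight Asup p \<noteq> -\<infinity>" "p \<noteq> []"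
  shows "(hd p, last p) \<in> parcs D ^^ (length p - 1)"
  unfolding parcs_D using vwalk_arcs_of_weight[of Asup p, OF sup_nonpos] assms
  by (intro vwalk_relpow) auto

lemma trellis_le_sup:
  "set As \<subseteq> Y \<Longrightarrow> length p = Suc (length As) \<Longrightarrow> trellis_weight As p \<le> walk_weight Asup p"
  using Y_le_sup by (intro trellis_weight_le_walk_weight) auto

lemma inf_le_trellis:
  "set As \<subseteq> Y \<Longrightarrow> length p = Suc (length As) \<Longrightarrow> walk_weight Ainf p \<le> trellis_weight As p"
  using inf_le_Y by (intro walk_weight_le_trellis_weight) auto

lemma prod_nonpos: "set As \<subseteq> Y \<Longrightarrow> trop_prod As $ i $ j \<le> 0"
  using Y_nonpos by (intro trop_prod_nonpos) auto

lemma trellis_nonpos: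
  "set As \<subseteq> Y \<Longrightarrow> length p = Suc (length As) \<Longrightarrow> trellis_weight As p \<le> 0"
  using Y_nonpos by (intro trellis_weight_nonpos) auto

lemma prod_walk:
  assumes "set As \<subseteq> Y" "trop_prod As $ i $ j \<noteq> -\<infinity>"
  obtains p where "length p = Suc (length As)" "hd p = i" "last p = j"
    "trellis_weight As p = trop_prod As $ i $ j" "(i, j) \<in> parcs D ^^ length As"
proof -
  have "\<exists>p. length p = Suc (length As) \<and> hd p = i \<and> last p = j
      \<and> trellis_weight As p = trop_prod As $ i $ j"
    by (rule trop_prod_attained) (use assms Y_nonpos in auto)
  then obtain p where p: "length p = Suc (length As)" "hd p = i" "last p = j"
      "trellis_weight As p = trop_prod As $ i $ j" by blast
  have "walk_weight Asup p \<noteq> -\<infinity>"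
    using trellis_le_sup[OF assms(1) p(1)] p(4) assms(2) by auto
  then have "(i, j) \<in> parcs D ^^ length As"
    using walk_weight_relpow_D[of p] p by (cases p) auto
  from that[OF p this] show thesis .
qed

lemma prod_append_ge:
  assumes "set As \<subseteq> Y" "l \<le> m"
  shows "trop_prod (take (m - l) (drop l As)) $ a $ b + trop_prod (drop m As) $ b $ c
    \<le> trop_prod (drop l As) $ a $ c"
proof -
  have "drop l As = take (m - l) (drop l As) @ drop (m - l) (drop l As)"
    by (rule append_take_drop_id[symmetric])
  also have "drop (m - l) (drop l As) = drop m As" using assms(2) by simp
  finally have eq: "drop l As = take (m - l) (drop l As) @ drop m As" .
  have "trop_prod (take (m - l) (drop l As)) $ a $ b + trop_prod (drop m As) $ b $ c
      \<le> trop_prod (take (m - l) (drop l As) @ drop m As) $ a $ c"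
    by (rule trop_prod_append_ge) (use assms(1) Y_nonpos in \<open>auto dest: in_set_dropD\<close>)
  then show ?thesis using eq by simp
qed

lemma prod_split_ge:
  assumes "set As \<subseteq> Y"
  shows "trop_prod (take l As) $ a $ b + trop_prod (drop l As) $ b $ c \<le> trop_prod As $ a $ c"
  using prod_append_ge[OF assms, of 0 l a b c] by simp

lemma prod_critical_walk:
  assumes "set As \<subseteq> Y" "(a, b) \<in> parcs C ^^ length As"
  shows "0 \<le> trop_prod As $ a $ b"
  by (rule trop_prod_zero_walk[OF _ assms(2)]) (use assms(1) Y_critical_zero in auto)

text \<open>Any critical walk from \<open>c\<close> to \<open>d\<close>, put between the two legs,
  gives a walk from \<open>i\<close> to \<open>j\<close>; comparison with the walk of length
  \<open>k'\<close> in \<open>D\<close> shows that its length has the residue of the gap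
  \<open>m\<close>. As \<open>C\<close> has the same period, Schwarz's bound gives a critical walk
  of length exactly \<open>m\<close>, of weight 0 whatever the factors. The residue of
  \<open>k'\<close> is all that is prescribed, because in \<open>csr_le_prod\<close> the walk at
  hand is longer than the product.\<close>

lemma bridge:
  assumes As: "set As \<subseteq> Y" and V: "c \<in> V" "d \<in> V"
    and walks: "(i, c) \<in> parcs D ^^ l1" "(d, j) \<in> parcs D ^^ l2" "(i, j) \<in> parcs D ^^ k'"
    and cong: "k' mod \<gamma> = length As mod \<gamma>"
    and len: "l1 + l2 + Sch \<gamma> (card V) \<le> length As"
  shows "trop_prod (drop (length As - l2) As) $ d $ j \<le> trop_prod (drop l1 As) $ c $ j"
proof -
  define m where "m = length As - l1 - l2"
  have m: "length As = (l1 + l2) + m" "Sch \<gamma> (card V) \<le> m" using len by (auto simp: m_def)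
  obtain m' where m': "(c, d) \<in> parcs C ^^ m'" using C.walk_ex V by blast
  then have "(c, d) \<in> parcs D ^^ m'" by (rule relpow_subset[OF parcs_C_sub_D])
  then have "(i, j) \<in> parcs D ^^ (l1 + m' + l2)" using walks by (blast intro: relpow_trans)
  then have "(l1 + m' + l2) mod \<gamma> = k' mod \<gamma>"
    using walks(3) by (intro D.walk_length_cong[of i j]) auto
  then have "(l1 + l2 + m') mod \<gamma> = (l1 + l2 + m) mod \<gamma>" unfolding cong m(1) by (simp only: ac_simps)
  then have "m mod \<gamma> = m' mod \<gamma>" by (metis cong_add_lcancel_nat cong_def)
  then have "(c, d) \<in> parcs C ^^ m" by (rule C.schwarz_bound[OF V(1) m' m(2)])
  moreover have eq: "length As - l2 - l1 = m" "l1 \<le> length As - l2" using m(1) by auto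
  ultimately have "0 \<le> trop_prod (take m (drop l1 As)) $ c $ d"
    by (intro prod_critical_walk) (use As m(1) in \<open>auto dest: in_set_takeD in_set_dropD\<close>)
  then have "0 + trop_prod (drop (length As - l2) As) $ d $ j
      \<le> trop_prod (take m (drop l1 As)) $ c $ d + trop_prod (drop (length As - l2) As) $ d $ j"
    by (rule add_right_mono)
  also have "\<dots> \<le> trop_prod (drop l1 As) $ c $ j"
    using prod_append_ge[OF As eq(2), of c d j] unfolding eq(1) .
  finally show ?thesis by simp
qed

text \<open>\<open>transient\<close> is defined by \<open>LEAST\<close>, which is informative only
  if some threshold exists; Schwarz's bound provides one.\<close>

lemma stable_powers:
  assumes t: "t * \<gamma> \<ge> transient (support_mat C) \<gamma>" and l: "l \<ge> t * \<gamma>"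
  shows "parcs C ^^ (l + N * \<gamma>) = parcs C ^^ l"
proof -
  let ?P = "\<lambda>T. \<forall>l\<ge>T. trop_pow (support_mat C) (l + \<gamma>) = trop_pow (support_mat C) l"
  have "?P (Sch \<gamma> (card V))"
  proof (intro allI impI)
    fix l assume l: "l \<ge> Sch \<gamma> (card V)"
    have "card V > 0" using V_nonempty by (simp add: card_gt_0_iff)
    then have pos: "l > 0" using Sch_pos[of "card V" \<gamma>] l by simp
    have "(a, b) \<in> parcs C ^^ (l + \<gamma>) \<longleftrightarrow> (a, b) \<in> parcs C ^^ l" for a b
    proof
      assume "(a, b) \<in> parcs C ^^ (l + \<gamma>)"
      then show "(a, b) \<in> parcs C ^^ l"
        using C.schwarz_bound[OF relpow_C_in_V(1), of a b "l + \<gamma>" b "l + \<gamma>" l] l pos by simp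
    next
      assume "(a, b) \<in> parcs C ^^ l"
      then show "(a, b) \<in> parcs C ^^ (l + \<gamma>)"
        using C.schwarz_bound[OF relpow_C_in_V(1), of a b l b l "l + \<gamma>"] l pos by simp
    qed
    then show "trop_pow (support_mat C) (l + \<gamma>) = trop_pow (support_mat C) l"
      unfolding trop_pow_support_eq_iff by auto
  qed
  then have "?P (transient (support_mat C) \<gamma>)" unfolding transient_def by (rule LeastI)
  then have step: "parcs C ^^ (l + \<gamma>) = parcs C ^^ l" if "l \<ge> t * \<gamma>" for l
    using that t unfolding trop_pow_support_eq_iff by auto
  show ?thesis
  proof (induction N)
    case (Suc N)
    have "parcs C ^^ (l + N * \<gamma> + \<gamma>) = parcs C ^^ (l + N * \<gamma>)" using step l by simp
    with Suc show ?case by (simp add: ac_simps)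
  qed simp
qed

text \<open>The left part is continued from \<open>c\<close> by critical arcs to a node
  \<open>a\<close>, and the right part is preceded by critical arcs from a node \<open>b\<close>, so
  that both get length k. The critical walk from \<open>b\<close> through \<open>c\<close> to
  \<open>a\<close> has k arcs, so every critical walk from \<open>a\<close> to \<open>b\<close> has
  length congruent to -k, like the CSR exponent \<open>E\<close>.\<close>

lemma pass_le_csr:
  assumes As: "set As \<subseteq> Y" and c: "c \<in> V" and l: "l \<le> length As"
    and t: "t * \<gamma> \<ge> transient (support_mat C) \<gamma>"
  shows "trop_prod (take l As) $ i $ c + trop_prod (drop l As) $ c $ j
    \<le> csr (support_mat C) \<gamma> t (length As) (trop_prod As) $ i $ j"
proof -
  let ?k = "length As"
  obtain a where a: "a \<in> V" "(c, a) \<in> parcs C ^^ (?k - l)" using C.succs[OF c] by blast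
  obtain b where b: "b \<in> V" "(b, c) \<in> parcs C ^^ l" using C.preds[OF c] by blast
  define E where "E = 2 * ((t + 1) * \<gamma>) - ?k mod \<gamma>"
  have r: "?k mod \<gamma> < \<gamma>" using C.period_pos by simp
  have r': "?k mod \<gamma> \<le> (t + 1) * \<gamma>" using r by simp
  have tE: "t * \<gamma> \<le> E" using r by (simp add: E_def)
  obtain m' where m': "(a, b) \<in> parcs C ^^ m'" using C.walk_ex a b by blast
  have "(b, b) \<in> parcs C ^^ (l + (?k - l) + m')"
    using relpow_trans[OF relpow_trans[OF b(2) a(2)] m'] .
  then have "\<gamma> dvd l + (?k - l) + m'" by (rule C.period_dvd[OF b(1)])
  then have "(?k + m') mod \<gamma> = 0" using l by simp
  moreover have "E + ?k mod \<gamma> = 2 * ((t + 1) * \<gamma>)" using r' by (simp add: E_def)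
  then have "(?k + E) mod \<gamma> = 0" by (metis add.commute mod_add_left_eq mod_mult_self2_is_0 mult.assoc)
  ultimately have cong: "E mod \<gamma> = m' mod \<gamma>" by (metis cong_add_lcancel_nat cong_def)
  \<comment> \<open>\<open>E\<close> itself may lie below Schwarz's bound, so the walk is found at
    length \<open>E + S * \<gamma>\<close> and shortened by \<open>stable_powers\<close>, where the
    choice of \<open>t\<close> enters.\<close>
  define S where "S = Sch \<gamma> (card V)"
  have "S \<le> S * \<gamma>" using C.period_pos by simp
  then have "S \<le> E + S * \<gamma>" by (rule trans_le_add2)
  then have "(a, b) \<in> parcs C ^^ (E + S * \<gamma>)"
    unfolding S_def by (rule C.schwarz_bound[OF a(1) m']) (use cong in simp)
  then have ab: "(a, b) \<in> parcs C ^^ E" unfolding stable_powers[OF t tE] .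
  have "0 \<le> trop_prod (drop l As) $ c $ a"
    by (rule prod_critical_walk) (use As a(2) in \<open>auto dest: in_set_dropD\<close>)
  then have "trop_prod (take l As) $ i $ c + 0
      \<le> trop_prod (take l As) $ i $ c + trop_prod (drop l As) $ c $ a"
    by (rule add_left_mono)
  also have "\<dots> \<le> trop_prod As $ i $ a" by (rule prod_split_ge[OF As])
  finally have 1: "trop_prod (take l As) $ i $ c \<le> trop_prod As $ i $ a" by simp
  have "0 \<le> trop_prod (take l As) $ b $ c"
    by (rule prod_critical_walk) (use As b(2) l in \<open>auto dest: in_set_takeD\<close>)
  then have "0 + trop_prod (drop l As) $ c $ j
      \<le> trop_prod (take l As) $ b $ c + trop_prod (drop l As) $ c $ j"
    by (rule add_right_mono)
  also have "\<dots> \<le> trop_prod As $ b $ j" by (rule prod_split_ge[OF As])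
  finally have 2: "trop_prod (drop l As) $ c $ j \<le> trop_prod As $ b $ j" by simp
  have "trop_prod (take l As) $ i $ c + trop_prod (drop l As) $ c $ j
      \<le> trop_prod As $ i $ a + trop_prod As $ b $ j"
    using 1 2 by (rule add_mono)
  also have "\<dots> \<le> csr (support_mat C) \<gamma> t ?k (trop_prod As) $ i $ j"
    by (rule csr_ge[OF r' ab[unfolded E_def]])
  finally show ?thesis .
qed

section \<open>The comparison value \<open>u\<close>\<close>

abbreviation "u i j \<equiv> max_path_to Ainf V i + max_path_from Ainf V j"

lemma reach_inf: "(a, b) \<in> {(i, j). Ainf $ i $ j \<noteq> -\<infinity>}\<^sup>*"
  unfolding parcs_D_inf[symmetric] by (rule D.connected) auto

text \<open>Every factor dominates \<open>Ainf\<close>, so the optimal paths keep at least their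
  weight wherever they are placed. They are put at the beginning and the end of the product; each
  has at most n - q arcs, so the gap is long enough for \<open>bridge\<close>.\<close>

lemma u_le_pass:
  assumes As: "set As \<subseteq> Y"
    and k: "2 * (CARD('n) - card V) + Sch \<gamma> (card V) \<le> length As"
    and walk: "(i, j) \<in> parcs D ^^ k'" "k' mod \<gamma> = length As mod \<gamma>"
  obtains l c where "c \<in> V" "l \<le> length As"
    "u i j \<le> trop_prod (take l As) $ i $ c + trop_prod (drop l As) $ c $ j"
proof -
  let ?k = "length As"
  obtain c0 where c0: "c0 \<in> V" using V_nonempty by blast
  obtain p c where p: "set p \<inter> V = {}" "c \<in> V" "hd (p @ [c]) = i" "distinct (p @ [c])"
      "max_path_to Ainf V i = walk_weight Ainf (p @ [c])" "walk_weight Ainf (p @ [c]) \<noteq> -\<infinity>"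
    using max_path_to_attained[OF inf_nonpos c0 reach_inf, of i] by blast
  obtain r d where r: "set r \<inter> V = {}" "d \<in> V" "last (d # r) = j" "distinct (d # r)"
      "max_path_from Ainf V j = walk_weight Ainf (d # r)" "walk_weight Ainf (d # r) \<noteq> -\<infinity>"
    using max_path_from_attained[OF inf_nonpos c0 reach_inf, of j] by blast
  let ?l1 = "length p" and ?l2 = "length r"
  have l: "?l1 \<le> CARD('n) - card V" "?l2 \<le> CARD('n) - card V"
    using distinct_avoiding_length[of _ V] p(1,4) r(1,4) by auto
  then have len: "?l1 + ?l2 + Sch \<gamma> (card V) \<le> ?k" using k by simp
  have wp: "walk_weight Asup (p @ [c]) \<noteq> -\<infinity>" "walk_weight Asup (d # r) \<noteq> -\<infinity>"
    using walk_weight_mono[of Ainf Asup "p @ [c]"] walk_weight_mono[of Ainf Asup "d # r"]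
      p(6) r(6) inf_le_sup by auto
  have ic: "(i, c) \<in> parcs D ^^ ?l1" and dj: "(d, j) \<in> parcs D ^^ ?l2"
    using walk_weight_relpow_D[OF wp(1)] walk_weight_relpow_D[OF wp(2)] p(3) r(3) by auto
  have "max_path_to Ainf V i \<le> trellis_weight (take ?l1 As) (p @ [c])"
    unfolding p(5) by (rule inf_le_trellis) (use As len in \<open>auto dest: in_set_takeD\<close>)
  also have "\<dots> \<le> trop_prod (take ?l1 As) $ hd (p @ [c]) $ last (p @ [c])"
    by (rule trellis_weight_le_prod) (use len in auto)
  finally have 1: "max_path_to Ainf V i \<le> trop_prod (take ?l1 As) $ i $ c" using p(3) by simp
  have "max_path_from Ainf V j \<le> trellis_weight (drop (?k - ?l2) As) (d # r)"
    unfolding r(5) by (rule inf_le_trellis) (use As len in \<open>auto dest: in_set_dropD\<close>)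
  also have "\<dots> \<le> trop_prod (drop (?k - ?l2) As) $ hd (d # r) $ last (d # r)"
    by (rule trellis_weight_le_prod) (use len in auto)
  also have "\<dots> = trop_prod (drop (?k - ?l2) As) $ d $ j" using r(3) by simp
  also have "\<dots> \<le> trop_prod (drop ?l1 As) $ c $ j"
    by (rule bridge[OF As p(2) r(2) ic dj walk len])
  finally have 2: "max_path_from Ainf V j \<le> trop_prod (drop ?l1 As) $ c $ j" .
  have "?l1 \<le> ?k" using len by simp
  from that[OF p(2) this add_mono[OF 1 2]] show thesis .
qed

text \<open>Turns the differences in \<open>csr_bound\<close> into real ones;
  \<open>x \<le> y\<close> provides the premise \<open>U \<le> a\<close> of
  \<open>rate_choice\<close>.\<close>

lemma max_path_to_real:
  "\<exists>x y. max_path_to Ainf V i = ereal x \<and> max_path_to Asup V i = ereal y \<and> x \<le> y"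
proof -
  obtain c0 where c0: "c0 \<in> V" using V_nonempty by blast
  obtain p c where p: "set p \<inter> V = {}" "c \<in> V" "hd (p @ [c]) = i" "distinct (p @ [c])"
      "max_path_to Ainf V i = walk_weight Ainf (p @ [c])" "walk_weight Ainf (p @ [c]) \<noteq> -\<infinity>"
    using max_path_to_attained[OF inf_nonpos c0 reach_inf, of i] by blast
  have "walk_weight Ainf (p @ [c]) \<le> walk_weight Asup (p @ [c])"
    by (rule walk_weight_mono) (rule inf_le_sup)
  also have "\<dots> \<le> max_path_to Asup V i"
    using path_weight_le_max_path_to[OF sup_nonpos p(4,2)] p(3) by simp
  finally have le: "max_path_to Ainf V i \<le> max_path_to Asup V i" unfolding p(5) .
  have "max_path_to Asup V i \<le> 0"
    unfolding max_path_to_def by (rule Sup_least) (use walk_weight_nonpos[OF sup_nonpos] in auto)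
  moreover have "max_path_to Ainf V i \<noteq> -\<infinity>" using p(5,6) by simp
  ultimately show ?thesis using le
    by (cases "max_path_to Ainf V i"; cases "max_path_to Asup V i") auto
qed

lemma max_path_from_real:
  "\<exists>x y. max_path_from Ainf V j = ereal x \<and> max_path_from Asup V j = ereal y \<and> x \<le> y"
proof -
  obtain c0 where c0: "c0 \<in> V" using V_nonempty by blast
  obtain p c where p: "set p \<inter> V = {}" "c \<in> V" "last (c # p) = j" "distinct (c # p)"
      "max_path_from Ainf V j = walk_weight Ainf (c # p)" "walk_weight Ainf (c # p) \<noteq> -\<infinity>"
    using max_path_from_attained[OF inf_nonpos c0 reach_inf, of j] by blast
  have "walk_weight Ainf (c # p) \<le> walk_weight Asup (c # p)"
    by (rule walk_weight_mono) (rule inf_le_sup)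
  also have "\<dots> \<le> max_path_from Asup V j"
    using path_weight_le_max_path_from[OF sup_nonpos p(4,2)] unfolding p(3) .
  finally have le: "max_path_from Ainf V j \<le> max_path_from Asup V j" unfolding p(5) .
  have "max_path_from Asup V j \<le> 0"
    unfolding max_path_from_def by (rule Sup_least) (use walk_weight_nonpos[OF sup_nonpos] in auto)
  moreover have "max_path_from Ainf V j \<noteq> -\<infinity>" using p(5,6) by simp
  ultimately show ?thesis using le
    by (cases "max_path_from Ainf V j"; cases "max_path_from Asup V j") auto
qed

lemma max_path_avoiding_nonpos: "max_path_avoiding Asup V i j \<le> 0"
  unfolding max_path_avoiding_def
  by (auto intro!: Sup_least walk_weight_nonpos[OF sup_nonpos])

text \<open>The real number \<open>\<mu>\<close> replaces the possibly infinite \<open>\<lambda>\<^sub>*\<close> for a fixed pair of nodes: once the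
  bound on \<open>k\<close> holds, walks that spend too long outside the critical nodes cannot compete with
  \<open>u\<close>.\<close>

lemma bound_consequences:
  fixes k :: nat
  assumes "ereal (real k) \<ge> csr_bound u (max_path_to Asup V) (max_path_from Asup V)
    (max_path_avoiding Asup V) (max_cycle_mean (remove_nodes Asup V)) \<gamma> CARD('n) (card V)"
  shows "2 * (CARD('n) - card V) + Sch \<gamma> (card V) \<le> k"
    and "\<exists>\<mu>\<le>0. max_cycle_mean (remove_nodes Asup V) \<le> ereal \<mu>
      \<and> max_path_to Asup V i + max_path_from Asup V j
        + ereal (\<mu> * (real k + 1 - real (Sch \<gamma> (card V)) - 2 * (real CARD('n) - real (card V)))) \<le> u i j
      \<and> max_path_avoiding Asup V i j + ereal (\<mu> * (real k - (real CARD('n) - real (card V)))) \<le> u i j"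
proof -
  define L where "L = max_cycle_mean (remove_nodes Asup V)"
  define N where "N = real CARD('n) - real (card V)"
  define s where "s = real (Sch \<gamma> (card V))"
  define g where "g = max_path_avoiding Asup V i j"
  obtain w a where wa: "max_path_to Ainf V i = ereal w" "max_path_to Asup V i = ereal a" "w \<le> a"
    using max_path_to_real[of i] by blast
  obtain v b where vb: "max_path_from Ainf V j = ereal v" "max_path_from Asup V j = ereal b" "v \<le> b"
    using max_path_from_real[of j] by blast
  have N: "N \<ge> 0" "N = real (CARD('n) - card V)" using card_set_le_CARD[of V] by (auto simp: N_def of_nat_diff)
  have "card V > 0" using V_nonempty by (simp add: card_gt_0_iff)
  then have s: "s \<ge> 1" using Sch_pos[of "card V" \<gamma>] by (simp add: s_def)
  define F where "F = (\<lambda>(i, j). (u i j - max_path_to Asup V i - max_path_from Asup V j) / L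
    + ereal (2 * N + s))"
  have "F (i, j) \<le> (MAX p\<in>UNIV. F p)" by (intro Max_ge) auto
  also have "\<dots> \<le> ereal (real k)"
    using assms unfolding csr_bound_def F_def N_def s_def L_def by simp
  finally have "(ereal (w + v) - ereal (a + b)) / L + ereal (2 * N + s) \<le> ereal (real k)"
    using wa vb by (simp add: F_def diff_diff_eq algebra_simps)
  note b1 = this
  have b2: "(ereal (w + v) - ereal G) / L + ereal (N + 1) \<le> ereal (real k)" if G: "g = ereal G" for G
  proof -
    define H where "H = (\<lambda>(i, j). (u i j - max_path_avoiding Asup V i j) / L + ereal (N + 1))"
    have "H (i, j) \<le> (SUP p\<in>{(i, j). max_path_avoiding Asup V i j > -\<infinity>}. H p)"
      by (rule SUP_upper) (use G in \<open>simp add: g_def\<close>)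
    also have "\<dots> \<le> ereal (real k)"
      using assms unfolding csr_bound_def H_def N_def L_def by simp
    finally show ?thesis using wa vb G by (simp add: H_def g_def)
  qed
  have wv: "w + v \<le> a + b" using wa(3) vb(3) by simp
  \<comment> \<open>Holds because a critical node exists; it lets the first bound alone yield
    \<open>N + 1 \<le> k\<close> when \<open>L = -\<infinity>\<close>.\<close>
  have c: "N + 1 \<le> 2 * N + s" using N s by simp
  note rc = rate_choice[OF max_cycle_mean_avoiding[folded L_def] wv b1 b2 c]
  have "real (2 * (CARD('n) - card V) + Sch \<gamma> (card V)) \<le> real k"
    using rc(1) N(2) by (simp add: s_def)
  then show "2 * (CARD('n) - card V) + Sch \<gamma> (card V) \<le> k" by linarith
  obtain \<mu> where \<mu>: "\<mu> < 0" "L \<le> ereal \<mu>" "\<mu> * (real k - (2 * N + s) + 1) \<le> w + v - (a + b)"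
      "\<And>G. g = ereal G \<Longrightarrow> \<mu> * (real k - N) \<le> w + v - G"
    using rc(2) by blast
  have "real k - (2 * N + s) + 1 = real k + 1 - s - 2 * N" by simp
  from \<mu>(3)[unfolded this] have 1: "a + b + \<mu> * (real k + 1 - s - 2 * N) \<le> w + v" by linarith
  have 2: "g + ereal (\<mu> * (real k - N)) \<le> ereal (w + v)"
  proof (cases g)
    case (real G)
    then show ?thesis using \<mu>(4)[OF real] by simp
  next
    case PInf
    then show ?thesis using max_path_avoiding_nonpos[of i j] by (simp add: g_def)
  qed simp
  show "\<exists>\<mu>\<le>0. max_cycle_mean (remove_nodes Asup V) \<le> ereal \<mu>
      \<and> max_path_to Asup V i + max_path_from Asup V j
        + ereal (\<mu> * (real k + 1 - real (Sch \<gamma> (card V)) - 2 * (real CARD('n) - real (card V)))) \<le> u i j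
      \<and> max_path_avoiding Asup V i j + ereal (\<mu> * (real k - (real CARD('n) - real (card V)))) \<le> u i j"
    unfolding N_def[symmetric] L_def[symmetric] s_def[symmetric] g_def[symmetric] wa vb
    using \<mu>(1,2) 1 2 by (intro exI[of _ \<mu>]) simp
qed

section \<open>The two inequalities between the product and its CSR form\<close>

context
  fixes As :: "'n trop_mat list" and t :: nat
  assumes As: "set As \<subseteq> Y"
    and len_pos: "length As \<ge> 1"
    and t: "t * \<gamma> \<ge> transient (support_mat C) \<gamma>"
    and bound: "ereal (real (length As)) \<ge> csr_bound u (max_path_to Asup V) (max_path_from Asup V)
      (max_path_avoiding Asup V) (max_cycle_mean (remove_nodes Asup V)) \<gamma> CARD('n) (card V)"
begin

lemma prod_le_csr:
  "trop_prod As $ i $ j \<le> csr (support_mat C) \<gamma> t (length As) (trop_prod As) $ i $ j"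
proof (cases "trop_prod As $ i $ j = -\<infinity>")
  case False
  obtain p where p: "length p = Suc (length As)" "hd p = i" "last p = j"
      "trellis_weight As p = trop_prod As $ i $ j" "(i, j) \<in> parcs D ^^ length As"
    using prod_walk[OF As False] by blast
  show ?thesis
  proof (cases "set p \<inter> V = {}")
    case True
    obtain \<mu> where \<mu>: "\<mu> \<le> 0" "max_cycle_mean (remove_nodes Asup V) \<le> ereal \<mu>"
        "max_path_avoiding Asup V i j
          + ereal (\<mu> * (real (length As) - (real CARD('n) - real (card V)))) \<le> u i j"
      using bound_consequences(2)[OF bound, of i j] by blast
    interpret avoiding_rate Asup V \<mu> by (rule avoiding_rateI[OF \<mu>(2,1)])
    have "trop_prod As $ i $ j \<le> walk_weight Asup p"
      using trellis_le_sup[OF As p(1)] p(4) by simp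
    also have "\<dots> \<le> max_path_avoiding Asup V i j
        + ereal (\<mu> * (real (length As) - (real CARD('n) - real (card V))))"
      using walk_avoiding_bound[OF True] p(1-3) len_pos by simp
    also note \<mu>(3)
    finally have le: "trop_prod As $ i $ j \<le> u i j" .
    obtain l c where lc: "c \<in> V" "l \<le> length As"
        "u i j \<le> trop_prod (take l As) $ i $ c + trop_prod (drop l As) $ c $ j"
      using u_le_pass[OF As bound_consequences(1)[OF bound] p(5) refl] by blast
    from le lc(3) have "trop_prod As $ i $ j
        \<le> trop_prod (take l As) $ i $ c + trop_prod (drop l As) $ c $ j"
      by (rule order_trans)
    also have "\<dots> \<le> csr (support_mat C) \<gamma> t (length As) (trop_prod As) $ i $ j"
      by (rule pass_le_csr[OF As lc(1,2) t])
    finally show ?thesis .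
  next
    case False
    then obtain p1 c p2 where s: "p = p1 @ c # p2" "c \<in> V" by (meson disjoint_iff split_list)
    let ?l = "length p1"
    have l: "?l \<le> length As" using p(1) s(1) by simp
    have "trop_prod As $ i $ j
        = trellis_weight (take ?l As) (p1 @ [c]) + trellis_weight (drop ?l As) (c # p2)"
      unfolding p(4)[symmetric] s(1) by (rule trellis_weight_append[OF l])
    also have "\<dots> \<le> trop_prod (take ?l As) $ hd (p1 @ [c]) $ last (p1 @ [c])
        + trop_prod (drop ?l As) $ hd (c # p2) $ last (c # p2)"
      by (intro add_mono trellis_weight_le_prod) (use p(1) s(1) in auto)
    also have "\<dots> = trop_prod (take ?l As) $ i $ c + trop_prod (drop ?l As) $ c $ j"
      using p(2,3) s(1) by (cases p1) auto
    also have "\<dots> \<le> csr (support_mat C) \<gamma> t (length As) (trop_prod As) $ i $ j"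
      by (rule pass_le_csr[OF As s(2) l t])
    finally show ?thesis .
  qed
qed simp

lemma csr_le_prod:
  "csr (support_mat C) \<gamma> t (length As) (trop_prod As) $ i $ j \<le> trop_prod As $ i $ j"
proof (cases "csr (support_mat C) \<gamma> t (length As) (trop_prod As) $ i $ j = -\<infinity>")
  case False
  let ?k = "length As"
  let ?E = "2 * ((t + 1) * \<gamma>) - ?k mod \<gamma>"
  have r: "?k mod \<gamma> < \<gamma>" using C.period_pos by simp
  then have r': "?k mod \<gamma> \<le> (t + 1) * \<gamma>" by simp
  obtain a b where ab: "(a, b) \<in> parcs C ^^ ?E"
      "csr (support_mat C) \<gamma> t ?k (trop_prod As) $ i $ j = trop_prod As $ i $ a + trop_prod As $ b $ j"
    using csr_attained[OF r' prod_nonpos[OF As] False] by blast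
  have np: "trop_prod As $ i $ a \<le> 0" "trop_prod As $ b $ j \<le> 0" using prod_nonpos[OF As] by auto
  then have nz: "trop_prod As $ i $ a \<noteq> -\<infinity>" "trop_prod As $ b $ j \<noteq> -\<infinity>"
    using False unfolding ab(2) by auto
  have "?E > 0" using r by simp
  then have abV: "a \<in> V" "b \<in> V" using relpow_C_in_V[OF ab(1)] by auto
  obtain p where p: "length p = Suc ?k" "hd p = i" "last p = a"
      "trellis_weight As p = trop_prod As $ i $ a" "(i, a) \<in> parcs D ^^ ?k"
    using prod_walk[OF As nz(1)] by blast
  obtain p' where p': "length p' = Suc ?k" "hd p' = b" "last p' = j"
      "trellis_weight As p' = trop_prod As $ b $ j" "(b, j) \<in> parcs D ^^ ?k"
    using prod_walk[OF As nz(2)] by blast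
  \<comment> \<open>The two walks with the critical walk between them are too long for the product
    but have the residue of k, which is what \<open>bridge\<close> and \<open>u_le_pass\<close> ask
    for.\<close>
  have "(i, j) \<in> parcs D ^^ (?k + ?E + ?k)"
    using relpow_trans[OF relpow_trans[OF p(5) relpow_subset[OF parcs_C_sub_D ab(1)]] p'(5)] .
  moreover have "(?k + ?E + ?k) mod \<gamma> = ?k mod \<gamma>"
  proof -
    have "(?k + ?E + ?k) mod \<gamma> = (?k + (?E + ?k mod \<gamma>)) mod \<gamma>"
      unfolding add.assoc[symmetric] by (rule mod_add_right_eq[symmetric])
    also have "?E + ?k mod \<gamma> = (2 * (t + 1)) * \<gamma>" using r' by simp
    also have "(?k + (2 * (t + 1)) * \<gamma>) mod \<gamma> = ?k mod \<gamma>" by (rule mod_mult_self1)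
    finally show ?thesis .
  qed
  ultimately obtain k' where ij: "(i, j) \<in> parcs D ^^ k'" "k' mod \<gamma> = ?k mod \<gamma>" by blast
  have ne: "p \<noteq> []" "p' \<noteq> []" using p(1) p'(1) by auto
  \<comment> \<open>Cutting \<open>p\<close> at its first and \<open>p'\<close> at its last critical
    node leaves legs whose other nodes are all noncritical, as \<open>walk_to_bound\<close> and
    \<open>walk_from_bound\<close> require.\<close>
  have "\<exists>x\<in>set p. x \<in> V" using last_in_set[OF ne(1)] p(3) abV(1) by blast
  from split_list_first_prop[OF this] obtain p1 c p2 where
    s: "p = p1 @ c # p2" "c \<in> V" "\<forall>y\<in>set p1. y \<notin> V" by blast
  have "\<exists>x\<in>set p'. x \<in> V" using hd_in_set[OF ne(2)] p'(2) abV(2) by blast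
  from split_list_last_prop[OF this] obtain r1 d r2 where
    s': "p' = r1 @ d # r2" "d \<in> V" "\<forall>y\<in>set r2. y \<notin> V" by blast
  let ?l1 = "length p1" and ?l2 = "length r2"
  let ?w1 = "trellis_weight (take ?l1 As) (p1 @ [c])"
  let ?w2 = "trellis_weight (drop (?k - ?l2) As) (d # r2)"
  have l: "?l1 \<le> ?k" "length r1 \<le> ?k" "?l2 \<le> ?k" "length r1 = ?k - ?l2"
    using p(1) p'(1) s(1) s'(1) by auto
  have takeY: "set (take m As) \<subseteq> Y" and dropY: "set (drop m As) \<subseteq> Y" for m
    using As by (auto dest: in_set_takeD in_set_dropD)
  have "trop_prod As $ i $ a = ?w1 + trellis_weight (drop ?l1 As) (c # p2)"
    unfolding p(4)[symmetric] s(1) by (rule trellis_weight_append[OF l(1)])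
  also have "\<dots> \<le> ?w1 + 0"
    by (intro add_left_mono trellis_nonpos dropY) (use p(1) s(1) in auto)
  finally have w1: "trop_prod As $ i $ a \<le> ?w1" by simp
  have "trop_prod As $ b $ j = trellis_weight (take (length r1) As) (r1 @ [d]) + ?w2"
    unfolding p'(4)[symmetric] s'(1) l(4)[symmetric] by (rule trellis_weight_append[OF l(2)])
  also have "\<dots> \<le> 0 + ?w2"
    by (intro add_right_mono trellis_nonpos takeY) (use p'(1) s'(1) in auto)
  finally have w2: "trop_prod As $ b $ j \<le> ?w2" by simp
  have hd1: "hd (p1 @ [c]) = i" using p(2) s(1) by (cases p1) auto
  have last2: "last (d # r2) = j" using p'(3) s'(1) by simp
  have sup1: "?w1 \<le> walk_weight Asup (p1 @ [c])"
    by (rule trellis_le_sup) (use takeY l(1) in auto)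
  have sup2: "?w2 \<le> walk_weight Asup (d # r2)"
    by (rule trellis_le_sup) (use dropY l(3) in auto)
  have csr_le: "csr (support_mat C) \<gamma> t ?k (trop_prod As) $ i $ j \<le> ?w1 + ?w2"
    unfolding ab(2) using w1 w2 by (rule add_mono)
  show ?thesis
  proof (cases "?l1 + ?l2 + Sch \<gamma> (card V) \<le> ?k")
    case True
    have "walk_weight Asup (p1 @ [c]) \<noteq> -\<infinity>" using w1 sup1 nz(1) by auto
    from walk_weight_relpow_D[OF this] have ic: "(i, c) \<in> parcs D ^^ ?l1" using hd1 by simp
    have "walk_weight Asup (d # r2) \<noteq> -\<infinity>" using w2 sup2 nz(2) by auto
    from walk_weight_relpow_D[OF this] have dj: "(d, j) \<in> parcs D ^^ ?l2" using last2 by simp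
    have "?w1 \<le> trop_prod (take ?l1 As) $ hd (p1 @ [c]) $ last (p1 @ [c])"
      by (rule trellis_weight_le_prod) (use l(1) in auto)
    then have 1: "?w1 \<le> trop_prod (take ?l1 As) $ i $ c" unfolding hd1 by simp
    have "?w2 \<le> trop_prod (drop (?k - ?l2) As) $ hd (d # r2) $ last (d # r2)"
      by (rule trellis_weight_le_prod) (use l(3) in auto)
    also have "\<dots> = trop_prod (drop (?k - ?l2) As) $ d $ j" unfolding last2 by simp
    also have "\<dots> \<le> trop_prod (drop ?l1 As) $ c $ j"
      by (rule bridge[OF As s(2) s'(2) ic dj ij True])
    finally have 2: "?w2 \<le> trop_prod (drop ?l1 As) $ c $ j" .
    have "?w1 + ?w2 \<le> trop_prod (take ?l1 As) $ i $ c + trop_prod (drop ?l1 As) $ c $ j"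
      using 1 2 by (rule add_mono)
    also have "\<dots> \<le> trop_prod As $ i $ j" by (rule prod_split_ge[OF As])
    finally show ?thesis by (rule order_trans[OF csr_le])
  next
    case False
    define N where "N = real CARD('n) - real (card V)"
    define s where "s = real (Sch \<gamma> (card V))"
    obtain \<mu> where \<mu>: "\<mu> \<le> 0" "max_cycle_mean (remove_nodes Asup V) \<le> ereal \<mu>"
        "max_path_to Asup V i + max_path_from Asup V j
          + ereal (\<mu> * (real ?k + 1 - s - 2 * N)) \<le> u i j"
      using bound_consequences(2)[OF bound, of i j] unfolding N_def s_def by blast
    interpret avoiding_rate Asup V \<mu> by (rule avoiding_rateI[OF \<mu>(2,1)])
    have "walk_weight Asup (p1 @ [c]) \<le> max_path_to Asup V i + ereal (\<mu> * (real ?l1 - N))"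
      using walk_to_bound[of p1 c] s(2,3) unfolding hd1 N_def by auto
    with sup1 have 1: "?w1 \<le> max_path_to Asup V i + ereal (\<mu> * (real ?l1 - N))" by (rule order_trans)
    have "walk_weight Asup (d # r2) \<le> max_path_from Asup V j + ereal (\<mu> * (real ?l2 - N))"
      using walk_from_bound[of r2 d] s'(2,3) unfolding last2 N_def by auto
    with sup2 have 2: "?w2 \<le> max_path_from Asup V j + ereal (\<mu> * (real ?l2 - N))" by (rule order_trans)
    \<comment> \<open>Negating the inequality between integers gives at least k + 1 - s arcs on the
      two legs; this is the extra 1 in \<open>bound_consequences\<close>.\<close>
    have "real ?k + 1 - s - 2 * N \<le> (real ?l1 - N) + (real ?l2 - N)"
      using False by (simp add: s_def)
    then have "\<mu> * ((real ?l1 - N) + (real ?l2 - N)) \<le> \<mu> * (real ?k + 1 - s - 2 * N)"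
      using \<mu>(1) by (rule mult_left_mono_neg)
    then have e: "ereal (\<mu> * (real ?l1 - N)) + ereal (\<mu> * (real ?l2 - N))
        \<le> ereal (\<mu> * (real ?k + 1 - s - 2 * N))"
      unfolding distrib_left by simp
    have "?w1 + ?w2 \<le> (max_path_to Asup V i + ereal (\<mu> * (real ?l1 - N)))
        + (max_path_from Asup V j + ereal (\<mu> * (real ?l2 - N)))"
      using 1 2 by (rule add_mono)
    also have "\<dots> = max_path_to Asup V i + max_path_from Asup V j
        + (ereal (\<mu> * (real ?l1 - N)) + ereal (\<mu> * (real ?l2 - N)))"
      by (simp only: ac_simps)
    also have "\<dots> \<le> max_path_to Asup V i + max_path_from Asup V j
        + ereal (\<mu> * (real ?k + 1 - s - 2 * N))"
      by (rule add_left_mono[OF e])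
    also note \<mu>(3)
    finally have le: "?w1 + ?w2 \<le> u i j" .
    obtain l c where lc: "u i j \<le> trop_prod (take l As) $ i $ c + trop_prod (drop l As) $ c $ j"
      using u_le_pass[OF As bound_consequences(1)[OF bound] ij] by blast
    also have "\<dots> \<le> trop_prod As $ i $ j" by (rule prod_split_ge[OF As])
    finally show ?thesis using csr_le le by (meson order_trans)
  qed
qed simp

end

end

theorem corollary5p9:
  fixes X Y :: "'n::finite trop_mat set"
    and D C :: "'n pair_pre_digraph"
    and S :: "'n trop_mat"
    and As :: "'n trop_mat list"
    and \<alpha> \<beta> w v :: "'n \<Rightarrow> ereal"
    and g u :: "'n \<Rightarrow> 'n \<Rightarrow> ereal"
    and L :: ereal
    and n q \<gamma> t k :: nat
  assumes "common_digraphs X Y D C"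
    and "n = CARD('n)"
    and "q = card (pverts C)"
    and "strongly_connected (with_proj C)"
    and "\<gamma> = cyclicity C"
    and "\<gamma> = cyclicity D"
    and "S = support_mat C"
    and "t * \<gamma> \<ge> transient S \<gamma>"
    and "\<alpha> = max_path_to (sup_mat Y) (pverts C)"
    and "\<beta> = max_path_from (sup_mat Y) (pverts C)"
    and "w = max_path_to (inf_mat Y) (pverts C)"
    and "v = max_path_from (inf_mat Y) (pverts C)"
    and "u = (\<lambda>i j. w i + v j)"
    and "g = max_path_avoiding (sup_mat Y) (pverts C)"
    and "L = max_cycle_mean (remove_nodes (sup_mat Y) (pverts C))"
    and "k \<ge> 1"
    and "ereal (real k) \<ge> csr_bound u \<alpha> \<beta> g L \<gamma> n q"
    and "length As = k"
    and "set As \<subseteq> Y"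
  shows "trop_prod As = csr S \<gamma> t k (trop_prod As)"
proof -
  interpret csr_setting X Y D C \<gamma>
    using assms(1,4-6) by (intro csr_setting.intro csr_setting_axioms.intro)
  have bound: "ereal (real (length As)) \<ge> csr_bound (\<lambda>i j. max_path_to (inf_mat Y) (pverts C) i
      + max_path_from (inf_mat Y) (pverts C) j) (max_path_to (sup_mat Y) (pverts C))
      (max_path_from (sup_mat Y) (pverts C)) (max_path_avoiding (sup_mat Y) (pverts C))
      (max_cycle_mean (remove_nodes (sup_mat Y) (pverts C))) \<gamma> CARD('n) (card (pverts C))"
    using assms(17) unfolding assms(2,3,9-15,18) .
  have len: "length As \<ge> 1" using assms(16,18) by simp
  have t: "t * \<gamma> \<ge> transient (support_mat C) \<gamma>" using assms(8) unfolding assms(7) .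
  have "trop_prod As $ i $ j = csr (support_mat C) \<gamma> t (length As) (trop_prod As) $ i $ j" for i j
    using prod_le_csr[OF assms(19) len t bound] csr_le_prod[OF assms(19) len t bound]
    by (rule order_antisym)
  then show ?thesis unfolding assms(7) by (simp add: vec_eq_iff assms(18))
qed

end
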